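(* Let $I\ge 2$, let $m=(m_{ij})_{1\le i\le I,\,1\le j\le J_i}$ be the true probability vector of a multinomial distribution with all $m_{ij}>0$, and consider the non-overlapping $m$-aggregation submodel defined by the restriction equations $$m_{i\cdot}=\sum_{j=1}^{J_i}m_{ij}=c_i,\qquad i=1,\ldots,I,$$ with known constants $c_i$ (satisfied by the true $m$). If none of these restriction equations is solid, i.e. $J_i\ge 2$ for every $i=1,\ldots,I$, then the second-order term (the $n^{-2}$-order term) in the asymptotic expansion of the risk of the MLE under the submodel is larger than the second-order term in the asymptotic expansion of the risk of the MLE under the full model. That is, if $$ED_{\mathrm{full}}(n)=\frac{a_1}{n}+\frac{a_2}{n^2}+o(n^{-2}),\qquad ED_{\mathrm{sub}}(n)=\frac{b_1}{n}+\frac{b_2}{n^2}+o(n^{-2})\qquad(n\to\infty)$$ are the asymptotic expansions of the risks of the MLE under the full model and under the submodel, respectively, then $b_2>a_2$.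
   Context: In each of $n$ independent trials, an observation falls in exactly one of the categories $C_{ij}$ ($1\le i\le I$, $1\le j\le J_i$) with probability $m_{ij}>0$, $\sum_{i,j}m_{ij}=1$. Let $X_{ij}$ be the number of observations in $C_{ij}$ and $X_{i\cdot}=\sum_{j}X_{ij}$. The full model is the multinomial model with no restriction on $m=(m_{ij})$ other than being a probability vector; its MLE is $\widehat m_{ij}=X_{ij}/n$. An $m$-aggregation submodel is obtained by prescribing the values of sums of some of the cell probabilities; it is non-overlapping if each cell probability appears in at most one restriction equation. Cell probabilities appearing in no restriction are collected into one further group, whose sum is then also known (since the total is $1$), so a non-overlapping submodel always takes the form $m_{i\cdot}=c_i$, $i=1,\ldots,I$, with the groups partitioning all cells. A restriction equation is solid if it gives the probability of one single cell, i.e. $J_i=1$. The MLE under the submodel is $\widehat m_{ij}=c_i\,X_{ij}/X_{i\cdot}$. For an estimator $\widehat m$, the risk is $E\bigl[D[\widehat m:m]\bigr]$, where $D[\widehat m:m]=\sum_{i,j}\widehat m_{ij}\log(\widehat m_{ij}/m_{ij})$ (with $0\log 0=0$) is the Kullback--Leibler divergence and the expectation is under the true $m$. Samples with $X_{i\cdot}=0$ for some $i$ are discarded, i.e. expectations are taken conditionally on $X_{i\cdot}\neq 0$ for all $i$. $ED_{\mathrm{full}}(n)$ and $ED_{\mathrm{sub}}(n)$ denote the risks of the two MLEs above at sample size $n$. *)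

theory Defs
  imports "HOL-Probability.Probability" "HOL-Library.Landau_Symbols"
begin

text \<open>
  A family \<open>(\<theta>\<^sub>i\<^sub>j)\<close> indexed by the cells is a function \<open>nat \<Rightarrow> nat \<Rightarrow> real\<close>; its values outside
  of the cells are irrelevant.
\<close>

definition cells :: "nat \<Rightarrow> (nat \<Rightarrow> nat) \<Rightarrow> (nat \<times> nat) set" where
  "cells I J = (SIGMA i:{1..I}. {1..J i})"

definition full_model :: "nat \<Rightarrow> (nat \<Rightarrow> nat) \<Rightarrow> (nat \<Rightarrow> nat \<Rightarrow> real) set" where
  "full_model I J =
     {\<theta>. (\<forall>(i, j) \<in> cells I J. 0 \<le> \<theta> i j) \<and> (\<Sum>(i, j) \<in> cells I J. \<theta> i j) = 1}"

definition submodel ::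
  "nat \<Rightarrow> (nat \<Rightarrow> nat) \<Rightarrow> (nat \<Rightarrow> real) \<Rightarrow> (nat \<Rightarrow> nat \<Rightarrow> real) set" where
  "submodel I J c = {\<theta> \<in> full_model I J. \<forall>i \<in> {1..I}. (\<Sum>j = 1..J i. \<theta> i j) = c i}"

definition trial_pmf :: "nat \<Rightarrow> (nat \<Rightarrow> nat) \<Rightarrow> (nat \<Rightarrow> nat \<Rightarrow> real) \<Rightarrow> (nat \<times> nat) pmf" where
  "trial_pmf I J \<theta> = embed_pmf (\<lambda>(i, j). if (i, j) \<in> cells I J then \<theta> i j else 0)"

definition counts :: "nat \<Rightarrow> (nat \<Rightarrow> nat \<times> nat) \<Rightarrow> nat \<Rightarrow> nat \<Rightarrow> nat" where
  "counts n \<omega> i j = card {k. k < n \<and> \<omega> k = (i, j)}"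

definition multinomial_pmf ::
  "nat \<Rightarrow> (nat \<Rightarrow> nat) \<Rightarrow> (nat \<Rightarrow> nat \<Rightarrow> real) \<Rightarrow> nat \<Rightarrow> (nat \<Rightarrow> nat \<Rightarrow> nat) pmf" where
  "multinomial_pmf I J \<theta> n =
     map_pmf (counts n) (Pi_pmf {..<n} undefined (\<lambda>_. trial_pmf I J \<theta>))"

text \<open>
  On a sample without empty group the maximiser below exists and is unique on the cells, see
  \<open>mle_full_model\<close> and \<open>mle_submodel\<close>.
\<close>

definition mle ::
  "nat \<Rightarrow> (nat \<Rightarrow> nat) \<Rightarrow> nat \<Rightarrow> (nat \<Rightarrow> nat \<Rightarrow> real) set \<Rightarrow> (nat \<Rightarrow> nat \<Rightarrow> nat) \<Rightarrow> nat \<Rightarrow> nat \<Rightarrow> real"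
  where "mle I J n \<Theta> x = arg_max_on (\<lambda>\<theta>. pmf (multinomial_pmf I J \<theta> n) x) \<Theta>"

text \<open>Since \<^term>\<open>0 * ln (0 :: real) = 0\<close>, the convention for empty cells is built in.\<close>

definition KL_div ::
  "nat \<Rightarrow> (nat \<Rightarrow> nat) \<Rightarrow> (nat \<Rightarrow> nat \<Rightarrow> real) \<Rightarrow> (nat \<Rightarrow> nat \<Rightarrow> real) \<Rightarrow> real" where
  "KL_div I J \<theta> m = (\<Sum>(i, j) \<in> cells I J. \<theta> i j * ln (\<theta> i j / m i j))"

definition no_empty_group :: "nat \<Rightarrow> (nat \<Rightarrow> nat) \<Rightarrow> (nat \<Rightarrow> nat \<Rightarrow> nat) set" where
  "no_empty_group I J = {x. \<forall>i \<in> {1..I}. (\<Sum>j = 1..J i. x i j) \<noteq> 0}"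

text \<open>
  For \<open>n < I\<close> the conditioning event is empty and the risk carries no meaning; only its behaviour
  for large \<open>n\<close> is of interest.
\<close>

definition risk ::
  "nat \<Rightarrow> (nat \<Rightarrow> nat) \<Rightarrow> (nat \<Rightarrow> nat \<Rightarrow> real) \<Rightarrow> nat \<Rightarrow>
     ((nat \<Rightarrow> nat \<Rightarrow> nat) \<Rightarrow> nat \<Rightarrow> nat \<Rightarrow> real) \<Rightarrow> real" where
  "risk I J m n est =
     measure_pmf.expectation (cond_pmf (multinomial_pmf I J m n) (no_empty_group I J))
       (\<lambda>x. KL_div I J (est x) m)"

definition ED_full :: "nat \<Rightarrow> (nat \<Rightarrow> nat) \<Rightarrow> (nat \<Rightarrow> nat \<Rightarrow> real) \<Rightarrow> nat \<Rightarrow> real" where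
  "ED_full I J m n = risk I J m n (mle I J n (full_model I J))"

definition ED_sub ::
  "nat \<Rightarrow> (nat \<Rightarrow> nat) \<Rightarrow> (nat \<Rightarrow> real) \<Rightarrow> (nat \<Rightarrow> nat \<Rightarrow> real) \<Rightarrow> nat \<Rightarrow> real" where
  "ED_sub I J c m n = risk I J m n (mle I J n (submodel I J c))"


lemma finite_cells [simp]: "finite (cells I J)"
  by (simp add: cells_def)

lemma sum_cells: "(\<Sum>(i, j) \<in> cells I J. f i j) = (\<Sum>i = 1..I. \<Sum>j = 1..J i. f i j)"
  unfolding cells_def by (rule sum.Sigma [symmetric]) auto

lemma prod_cells: "(\<Prod>(i, j) \<in> cells I J. f i j) = (\<Prod>i = 1..I. \<Prod>j = 1..J i. f i j)"
  unfolding cells_def by (rule prod.Sigma [symmetric]) auto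

lemma pmf_trial_pmf:
  assumes "\<theta> \<in> full_model I J"
  shows "pmf (trial_pmf I J \<theta>) a = (if a \<in> cells I J then case_prod \<theta> a else 0)"
proof -
  let ?f = "\<lambda>(i, j). if (i, j) \<in> cells I J then \<theta> i j else 0"
  have nn: "0 \<le> ?f b" for b
    using assms by (auto simp: full_model_def split: prod.splits)
  have eq: "?f b = (if b \<in> cells I J then case_prod \<theta> b else 0)" for b
    by (auto split: prod.splits)
  have "(\<integral>\<^sup>+ b. ennreal (?f b) \<partial>count_space UNIV)
      = (\<integral>\<^sup>+ b. ennreal (case_prod \<theta> b) * indicator (cells I J) b \<partial>count_space UNIV)"
    by (intro nn_integral_cong) (auto simp: eq indicator_def)
  also have "\<dots> = (\<integral>\<^sup>+ b. ennreal (case_prod \<theta> b) \<partial>count_space (cells I J))"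
    by (simp add: nn_integral_count_space_indicator)
  also have "\<dots> = (\<Sum>b \<in> cells I J. ennreal (case_prod \<theta> b))"
    by (simp add: nn_integral_count_space_finite)
  also have "\<dots> = ennreal (\<Sum>b \<in> cells I J. case_prod \<theta> b)"
    using assms by (intro sum_ennreal) (auto simp: full_model_def)
  also have "\<dots> = 1"
    using assms by (simp add: full_model_def)
  finally have "pmf (embed_pmf ?f) a = ?f a"
    by (intro pmf_embed_pmf nn)
  then show ?thesis
    by (simp only: trial_pmf_def eq)
qed

lemma set_pmf_trial_pmf: "\<theta> \<in> full_model I J \<Longrightarrow> set_pmf (trial_pmf I J \<theta>) \<subseteq> cells I J"
  by (auto simp: set_pmf_iff pmf_trial_pmf split: if_splits)

lemma pmf_multinomial_pmf:
  assumes "\<theta> \<in> full_model I J"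
  shows "pmf (multinomial_pmf I J \<theta> n) x
       = real (card {\<omega> \<in> PiE_dflt {..<n} undefined (\<lambda>_. cells I J). counts n \<omega> = x})
         * (\<Prod>(i, j) \<in> cells I J. \<theta> i j ^ x i j)"
proof -
  let ?P = "Pi_pmf {..<n} undefined (\<lambda>_. trial_pmf I J \<theta>)"
  let ?\<Omega> = "PiE_dflt {..<n} undefined (\<lambda>_. cells I J)"
  let ?S = "{\<omega> \<in> ?\<Omega>. counts n \<omega> = x}"
  have fin: "finite ?S"
    by (rule finite_subset [of _ ?\<Omega>]) (auto intro!: finite_PiE_dflt)
  have sub: "set_pmf ?P \<subseteq> ?\<Omega>"
    using set_pmf_trial_pmf [OF assms] set_Pi_pmf_subset' [of "{..<n}" undefined]
    by (fastforce simp: PiE_dflt_def)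
  have "pmf (multinomial_pmf I J \<theta> n) x = measure_pmf.prob ?P (counts n -` {x})"
    by (simp add: multinomial_pmf_def pmf_map)
  also have "\<dots> = measure_pmf.prob ?P ?S"
    using sub by (intro measure_eq_AE) (auto simp: AE_measure_pmf_iff)
  also have "\<dots> = (\<Sum>\<omega> \<in> ?S. pmf ?P \<omega>)"
    using fin by (rule measure_measure_pmf_finite)
  also have "\<dots> = (\<Sum>\<omega> \<in> ?S. \<Prod>(i, j) \<in> cells I J. \<theta> i j ^ x i j)"
  proof (intro sum.cong refl)
    fix \<omega> assume \<omega>: "\<omega> \<in> ?S"
    then have c: "\<omega> k \<in> cells I J" if "k < n" for k
      using that by (auto simp: PiE_dflt_def)
    have "pmf ?P \<omega> = (\<Prod>k<n. pmf (trial_pmf I J \<theta>) (\<omega> k))"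
      using \<omega> by (intro pmf_Pi') (auto simp: PiE_dflt_def)
    also have "\<dots> = (\<Prod>k<n. case_prod \<theta> (\<omega> k))"
      using c by (intro prod.cong) (auto simp: pmf_trial_pmf [OF assms])
    also have "\<dots> = (\<Prod>a \<in> cells I J. \<Prod>k \<in> {k \<in> {..<n}. \<omega> k = a}. case_prod \<theta> (\<omega> k))"
      using c by (intro prod.group [symmetric]) auto
    also have "\<dots> = (\<Prod>(i, j) \<in> cells I J. \<theta> i j ^ x i j)"
      using \<omega> by (intro prod.cong) (auto simp: counts_def)
    finally show "pmf ?P \<omega> = (\<Prod>(i, j) \<in> cells I J. \<theta> i j ^ x i j)" .
  qed
  finally show ?thesis by simp
qed

lemma sum_counts:
  assumes "m \<in> full_model I J" "x \<in> set_pmf (multinomial_pmf I J m n)"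
  shows "(\<Sum>(i, j) \<in> cells I J. x i j) = n"
proof -
  have "card {\<omega> \<in> PiE_dflt {..<n} undefined (\<lambda>_. cells I J). counts n \<omega> = x} \<noteq> 0"
    using assms by (auto simp: set_pmf_iff pmf_multinomial_pmf)
  then have "{\<omega> \<in> PiE_dflt {..<n} undefined (\<lambda>_. cells I J). counts n \<omega> = x} \<noteq> {}"
    by (metis card.empty)
  then obtain \<omega> where \<omega>: "\<omega> \<in> PiE_dflt {..<n} undefined (\<lambda>_. cells I J)" "counts n \<omega> = x"
    by auto
  have "n = (\<Sum>k<n. 1)" by simp
  also have "\<dots> = (\<Sum>a \<in> cells I J. \<Sum>k \<in> {k \<in> {..<n}. \<omega> k = a}. 1)"
    using \<omega>(1) by (intro sum.group [symmetric]) (auto simp: PiE_dflt_def)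
  also have "\<dots> = (\<Sum>(i, j) \<in> cells I J. x i j)"
    using \<omega>(2) by (intro sum.cong) (auto simp: counts_def)
  finally show ?thesis ..
qed

lemma prod_power_frequencies:
  fixes x :: "'a \<Rightarrow> nat" and \<theta> :: "'a \<Rightarrow> real"
  assumes A: "finite A" and N: "(\<Sum>a\<in>A. x a) \<noteq> 0"
    and nn: "\<And>a. a \<in> A \<Longrightarrow> 0 \<le> \<theta> a" and c: "(\<Sum>a\<in>A. \<theta> a) = c" "0 < c"
  defines "p \<equiv> \<lambda>a. c * x a / (\<Sum>a\<in>A. x a)"
  shows "(\<Prod>a\<in>A. \<theta> a ^ x a) \<le> (\<Prod>a\<in>A. p a ^ x a)"
    and "(\<Prod>a\<in>A. \<theta> a ^ x a) = (\<Prod>a\<in>A. p a ^ x a) \<Longrightarrow> a \<in> A \<Longrightarrow> \<theta> a = p a"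
    and "0 < (\<Prod>a\<in>A. p a ^ x a)"
proof -
  define N where "N = real (\<Sum>a\<in>A. x a)"
  have N0: "N > 0"
    unfolding N_def using N by (simp only: of_nat_0_less_iff neq0_conv)
  have p: "p a = c * x a / N" for a
    by (simp add: p_def N_def)
  define B where "B = {a \<in> A. x a \<noteq> 0}"
  have B: "finite B" "B \<subseteq> A"
    using A by (auto simp: B_def)
  have pB: "p a > 0" if "a \<in> B" for a
    using that N0 c by (auto simp: p B_def)
  have restrict: "(\<Prod>a\<in>A. f a ^ x a) = (\<Prod>a\<in>B. f a ^ x a)" for f :: "'a \<Rightarrow> real"
    using A B by (intro prod.mono_neutral_right) (auto simp: B_def)
  show pos: "0 < (\<Prod>a\<in>A. p a ^ x a)"
    unfolding restrict by (intro prod_pos ballI zero_less_power pB)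
  have sumx: "(\<Sum>a\<in>B. real (x a)) = N"
    unfolding N_def of_nat_sum using A B by (intro sum.mono_neutral_left) (auto simp: B_def)
  have sub: "(\<Sum>a\<in>B. \<theta> a) \<le> c"
    unfolding c(1) [symmetric] using A B nn by (intro sum_mono2) auto
  have strict: "(\<Prod>a\<in>A. \<theta> a ^ x a) < (\<Prod>a\<in>A. p a ^ x a)" if b: "b \<in> A" "\<theta> b \<noteq> p b" for b
  proof (cases "\<exists>a\<in>B. \<theta> a = 0")
    case True
    then have "(\<Prod>a\<in>B. \<theta> a ^ x a) = 0"
      using B by (subst prod_zero_iff) (auto simp: B_def)
    then show ?thesis
      using pos by (simp add: restrict)
  next
    case False
    then have tB: "\<theta> a > 0" if "a \<in> B" for a
      using nn that B by (metis less_eq_real_def subsetD)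
    have "\<exists>b\<in>B. \<theta> b \<noteq> p b"
    proof (rule ccontr)
      assume nb: "\<not> (\<exists>b\<in>B. \<theta> b \<noteq> p b)"
      then have "(\<Sum>a\<in>B. \<theta> a) = (\<Sum>a\<in>B. c / N * x a)"
        by (intro sum.cong) (auto simp: p)
      also have "\<dots> = c"
        unfolding sum_distrib_left [symmetric] sumx using N0 by simp
      finally have "(\<Sum>a\<in>A - B. \<theta> a) = 0"
        using A B c by (simp add: sum_diff)
      then have "\<forall>a\<in>A - B. \<theta> a = 0"
        using A nn by (subst (asm) sum_nonneg_eq_0_iff) auto
      then show False
        using b nb by (auto simp: B_def p)
    qed
    then obtain b where b: "b \<in> B" "\<theta> b \<noteq> p b" ..
    have le: "x a * ln (\<theta> a / p a) \<le> x a * (\<theta> a / p a - 1)" if "a \<in> B" for a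
      using pB [OF that] tB [OF that] by (intro mult_left_mono ln_le_minus_one) auto
    have "ln (\<theta> b / p b) \<noteq> \<theta> b / p b - 1"
      using pB [OF b(1)] tB [OF b(1)] b(2) ln_eq_minus_one [of "\<theta> b / p b"] by auto
    then have "ln (\<theta> b / p b) < \<theta> b / p b - 1"
      using pB [OF b(1)] tB [OF b(1)] ln_le_minus_one [of "\<theta> b / p b"] by simp
    then have "x b * ln (\<theta> b / p b) < x b * (\<theta> b / p b - 1)"
      using b by (intro mult_strict_left_mono) (auto simp: B_def)
    then have "(\<Sum>a\<in>B. x a * ln (\<theta> a / p a)) < (\<Sum>a\<in>B. x a * (\<theta> a / p a - 1))"
      using B b le by (intro sum_strict_mono_ex1) auto
    also have "\<dots> = (\<Sum>a\<in>B. N / c * \<theta> a - x a)"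
      using N0 c by (intro sum.cong) (auto simp: B_def p field_simps)
    also have "\<dots> = N / c * (\<Sum>a\<in>B. \<theta> a) - N"
      unfolding sum_subtractf sum_distrib_left [symmetric] sumx ..
    also have "\<dots> \<le> N / c * c - N"
      using sub N0 c by (intro diff_right_mono mult_left_mono) auto
    finally have "(\<Sum>a\<in>B. x a * ln (\<theta> a / p a)) < 0"
      using c by simp
    also have "(\<Sum>a\<in>B. x a * ln (\<theta> a / p a)) = (\<Sum>a\<in>B. ln (\<theta> a ^ x a)) - (\<Sum>a\<in>B. ln (p a ^ x a))"
      unfolding sum_subtractf [symmetric]
    proof (intro sum.cong refl)
      fix a assume "a \<in> B"
      then show "x a * ln (\<theta> a / p a) = ln (\<theta> a ^ x a) - ln (p a ^ x a)"
        using pB [of a] tB [of a] by (simp add: ln_div ln_realpow right_diff_distrib)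
    qed
    also have "\<dots> = ln (\<Prod>a\<in>B. \<theta> a ^ x a) - ln (\<Prod>a\<in>B. p a ^ x a)"
      using B pB tB by (subst (1 2) ln_prod) (fastforce intro: zero_less_power)+
    finally have "ln (\<Prod>a\<in>B. \<theta> a ^ x a) < ln (\<Prod>a\<in>B. p a ^ x a)"
      by simp
    then show ?thesis
      unfolding restrict using pB tB
      by (subst (asm) ln_less_cancel_iff) (auto intro!: prod_pos zero_less_power)
  qed
  show "(\<Prod>a\<in>A. \<theta> a ^ x a) \<le> (\<Prod>a\<in>A. p a ^ x a)"
  proof (cases "\<exists>b\<in>A. \<theta> b \<noteq> p b")
    case True
    then show ?thesis using strict by (auto intro: less_imp_le)
  next
    case False
    then show ?thesis by simp
  qed
  show "\<theta> a = p a" if "(\<Prod>a\<in>A. \<theta> a ^ x a) = (\<Prod>a\<in>A. p a ^ x a)" "a \<in> A"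
    using strict that by force
qed

lemma mle_is_maximiser:
  assumes m: "m \<in> full_model I J" "x \<in> set_pmf (multinomial_pmf I J m n)"
    and \<Theta>: "\<Theta> \<subseteq> full_model I J" "\<phi> \<in> \<Theta>"
    and max: "\<And>\<theta>. \<theta> \<in> \<Theta> \<Longrightarrow>
      (\<Prod>(i, j) \<in> cells I J. \<theta> i j ^ x i j) \<le> (\<Prod>(i, j) \<in> cells I J. \<phi> i j ^ x i j)"
  shows "mle I J n \<Theta> x \<in> \<Theta>"
    and "(\<Prod>(i, j) \<in> cells I J. mle I J n \<Theta> x i j ^ x i j)
       = (\<Prod>(i, j) \<in> cells I J. \<phi> i j ^ x i j)"
proof -
  let ?f = "\<lambda>\<theta>. pmf (multinomial_pmf I J \<theta> n) x"
  let ?K = "real (card {\<omega> \<in> PiE_dflt {..<n} undefined (\<lambda>_. cells I J). counts n \<omega> = x})"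
  have f: "?f \<theta> = ?K * (\<Prod>(i, j) \<in> cells I J. \<theta> i j ^ x i j)" if "\<theta> \<in> \<Theta>" for \<theta>
    using that \<Theta> by (intro pmf_multinomial_pmf) auto
  have K: "?K > 0"
    using m by (auto simp: set_pmf_iff pmf_multinomial_pmf intro!: gr0I)
  have "is_arg_max ?f (\<lambda>\<theta>. \<theta> \<in> \<Theta>) \<phi>"
    unfolding is_arg_max_linorder using \<Theta> max by (auto simp: f intro!: mult_left_mono)
  then have am: "is_arg_max ?f (\<lambda>\<theta>. \<theta> \<in> \<Theta>) (mle I J n \<Theta> x)"
    unfolding mle_def arg_max_on_def arg_max_def
    by (rule someI [where P = "is_arg_max ?f (\<lambda>\<theta>. \<theta> \<in> \<Theta>)"])
  then show mem: "mle I J n \<Theta> x \<in> \<Theta>"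
    by (simp add: is_arg_max_def)
  have "?f \<phi> \<le> ?f (mle I J n \<Theta> x)"
    using am \<Theta> by (simp add: is_arg_max_linorder)
  then have "(\<Prod>(i, j) \<in> cells I J. \<phi> i j ^ x i j)
      \<le> (\<Prod>(i, j) \<in> cells I J. mle I J n \<Theta> x i j ^ x i j)"
    unfolding f [OF mem] f [OF \<Theta>(2)] using K by (rule mult_left_le_imp_le)
  with max [OF mem]
  show "(\<Prod>(i, j) \<in> cells I J. mle I J n \<Theta> x i j ^ x i j)
      = (\<Prod>(i, j) \<in> cells I J. \<phi> i j ^ x i j)"
    by (rule antisym)
qed

lemma mle_full_model:
  assumes m: "m \<in> full_model I J" "x \<in> set_pmf (multinomial_pmf I J m n)"
    and n: "0 < n" and ij: "(i, j) \<in> cells I J"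
  shows "mle I J n (full_model I J) x i j = x i j / n"
proof -
  let ?\<phi> = "\<lambda>i j. x i j / real n"
  have sum: "(\<Sum>a \<in> cells I J. case_prod x a) = n"
    using sum_counts [OF m] by simp
  have pw: "(\<Prod>(i, j) \<in> cells I J. \<theta> i j ^ x i j) = (\<Prod>a \<in> cells I J. case_prod \<theta> a ^ case_prod x a)"
    for \<theta> :: "nat \<Rightarrow> nat \<Rightarrow> real"
    by (intro prod.cong) auto
  have \<phi>: "case_prod ?\<phi> a = (1::real) * case_prod x a / (\<Sum>a \<in> cells I J. case_prod x a)" for a
    unfolding sum by (simp split: prod.splits)
  have fm: "\<And>a. a \<in> cells I J \<Longrightarrow> 0 \<le> case_prod \<theta> a" "(\<Sum>a \<in> cells I J. case_prod \<theta> a) = 1"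
    if "\<theta> \<in> full_model I J" for \<theta>
    using that by (auto simp: full_model_def)
  have "(\<Sum>a \<in> cells I J. case_prod ?\<phi> a) = (\<Sum>a \<in> cells I J. real (case_prod x a)) / n"
    unfolding sum_divide_distrib by (intro sum.cong) auto
  also have "\<dots> = 1"
    using n by (simp only: of_nat_sum [symmetric] sum) simp
  finally have mem: "?\<phi> \<in> full_model I J"
    by (simp add: full_model_def)
  have N: "(\<Sum>a \<in> cells I J. case_prod x a) \<noteq> 0"
    using sum n by simp
  have max: "(\<Prod>(i, j) \<in> cells I J. \<theta> i j ^ x i j) \<le> (\<Prod>(i, j) \<in> cells I J. ?\<phi> i j ^ x i j)"
    if "\<theta> \<in> full_model I J" for \<theta>
    unfolding pw \<phi> by (rule prod_power_frequencies(1)) (use N fm [OF that] in auto)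
  note mle = mle_is_maximiser [OF m order_refl mem max]
  have "case_prod (mle I J n (full_model I J) x) (i, j)
      = (1::real) * case_prod x (i, j) / (\<Sum>a \<in> cells I J. case_prod x a)"
    by (rule prod_power_frequencies(2) [OF _ N]) (use fm [OF mle(1)] mle(2) ij in \<open>auto simp: pw \<phi>\<close>)
  then show ?thesis
    unfolding sum by simp
qed

lemma mle_submodel:
  assumes m: "m \<in> full_model I J" "x \<in> set_pmf (multinomial_pmf I J m n)"
    and x: "x \<in> no_empty_group I J"
    and c: "\<And>i. i \<in> {1..I} \<Longrightarrow> 0 < c i" "(\<Sum>i = 1..I. c i) = 1"
    and ij: "(i, j) \<in> cells I J"
  shows "mle I J n (submodel I J c) x i j = c i * x i j / (\<Sum>j = 1..J i. x i j)"
proof -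
  define \<phi> where "\<phi> = (\<lambda>i j. c i * x i j / (\<Sum>j = 1..J i. x i j))"
  have N: "(\<Sum>j = 1..J i. x i j) \<noteq> 0" if "i \<in> {1..I}" for i
    using x that by (auto simp: no_empty_group_def)
  have sm: "\<And>j. j \<in> {1..J i} \<Longrightarrow> 0 \<le> \<theta> i j" "(\<Sum>j = 1..J i. \<theta> i j) = c i"
    if "\<theta> \<in> submodel I J c" "i \<in> {1..I}" for \<theta> i
    using that by (auto simp: submodel_def full_model_def cells_def)
  have grp: "(\<Sum>j = 1..J i. \<phi> i j) = c i" if "i \<in> {1..I}" for i
  proof -
    have "(\<Sum>j = 1..J i. \<phi> i j) = c i * real (\<Sum>j = 1..J i. x i j) / real (\<Sum>j = 1..J i. x i j)"
      unfolding \<phi>_def of_nat_sum sum_divide_distrib [symmetric] sum_distrib_left [symmetric] ..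
    then show ?thesis
      using N [OF that] by (metis nonzero_mult_div_cancel_right of_nat_eq_0_iff)
  qed
  have "0 \<le> \<phi> i j" if "i \<in> {1..I}" for i j
    using c(1) [OF that] by (simp add: \<phi>_def del: of_nat_sum)
  then have mem: "\<phi> \<in> submodel I J c"
    using grp c(2) by (simp add: submodel_def full_model_def sum_cells) (auto simp: cells_def)
  have le: "(\<Prod>j = 1..J i. \<theta> i j ^ x i j) \<le> (\<Prod>j = 1..J i. \<phi> i j ^ x i j)"
    if "\<theta> \<in> submodel I J c" "i \<in> {1..I}" for \<theta> i
    unfolding \<phi>_def by (rule prod_power_frequencies(1)) (use N sm [OF that] c(1) that in auto)
  have nn: "0 \<le> (\<Prod>j = 1..J i. \<theta> i j ^ x i j)"
    if "\<theta> \<in> submodel I J c" "i \<in> {1..I}" for \<theta> i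
    using sm [OF that] by (intro prod_nonneg) auto
  have pos: "0 < (\<Prod>j = 1..J i. \<phi> i j ^ x i j)" if "i \<in> {1..I}" for i
    unfolding \<phi>_def
    by (rule prod_power_frequencies(3) [where \<theta> = "\<phi> i"]) (use N sm [OF mem that] c(1) that in auto)
  have max: "(\<Prod>(i, j) \<in> cells I J. \<theta> i j ^ x i j) \<le> (\<Prod>(i, j) \<in> cells I J. \<phi> i j ^ x i j)"
    if "\<theta> \<in> submodel I J c" for \<theta>
    unfolding prod_cells by (intro prod_mono conjI le nn that)
  have sub: "submodel I J c \<subseteq> full_model I J"
    by (auto simp: submodel_def)
  note mle = mle_is_maximiser [OF m sub mem max]
  define \<mu> where "\<mu> = mle I J n (submodel I J c) x"
  have \<mu>: "\<mu> \<in> submodel I J c"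
    and eq: "(\<Prod>i = 1..I. \<Prod>j = 1..J i. \<mu> i j ^ x i j) = (\<Prod>i = 1..I. \<Prod>j = 1..J i. \<phi> i j ^ x i j)"
    using mle by (simp_all add: \<mu>_def prod_cells)
  have i: "i \<in> {1..I}" and j: "j \<in> {1..J i}"
    using ij by (auto simp: cells_def)
  have eq_i: "(\<Prod>j = 1..J i. \<mu> i j ^ x i j) = (\<Prod>j = 1..J i. \<phi> i j ^ x i j)"
  proof (rule ccontr)
    assume "\<not> ?thesis"
    then have "(\<Prod>j = 1..J i. \<mu> i j ^ x i j) < (\<Prod>j = 1..J i. \<phi> i j ^ x i j)"
      using le [OF \<mu> i] by simp
    then have "(\<Prod>i = 1..I. \<Prod>j = 1..J i. \<mu> i j ^ x i j) < (\<Prod>i = 1..I. \<Prod>j = 1..J i. \<phi> i j ^ x i j)"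
      by (intro prod_mono_strict [OF i] conjI le nn \<mu> pos) auto
    with eq show False by simp
  qed
  have "\<mu> i j = c i * x i j / (\<Sum>j = 1..J i. x i j)"
    by (rule prod_power_frequencies(2) [OF _ N [OF i] _ _ c(1) [OF i], where \<theta> = "\<mu> i"])
       (use sm [OF \<mu> i] eq_i j in \<open>auto simp: \<phi>_def\<close>)
  then show ?thesis
    by (simp only: \<mu>_def)
qed

end

theory Submission
  imports Defs "HOL-Real_Asymp.Real_Asymp"
begin

text \<open>
  Both risks are sums of terms \<open>m E[\<phi>(X / (N q))]\<close> with \<open>\<phi>(u) = u ln u\<close>, where \<open>X\<close> counts a cell,
  \<open>N\<close> counts a set \<open>G\<close> of cells containing it, \<open>w\<close> is the probability of \<open>G\<close> and \<open>q = m / w\<close>: in the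
  full model \<open>G\<close> consists of all cells (so \<open>N = n\<close>), in the submodel \<open>G\<close> is the group of the cell.
  Given \<open>N\<close>, the count \<open>X\<close> is binomial, and Taylor expansion of \<open>\<phi>\<close> at \<open>1\<close> with central moments up
  to order six gives \<open>E[\<phi>(X / (N q)) | N] = (1 - q) / (2 q N) + (1 - q\<^sup>2) / (12 q\<^sup>2 N\<^sup>2) + O(N\<^bsup>-3\<^esup>)\<close>.
  Averaging over the binomial \<open>N\<close> costs a factor \<open>1 + (1 - w) / (n w)\<close> in the leading term, and
  conditioning on nonempty groups only costs an exponentially small error. Hence
  \<open>b\<^sub>2 - a\<^sub>2 = 1/12 + \<Sum>\<^sub>i ((J\<^sub>i - 1) (1 - c\<^sub>i) / (2 c\<^sub>i) - 1 / (12 c\<^sub>i))\<close>, which is positive because \<open>J\<^sub>i \<ge> 2\<close>,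
  \<open>1 / c\<^sub>i \<ge> 4 - 4 c\<^sub>i\<close> and \<open>\<Sum>\<^sub>i c\<^sub>i = 1\<close>.
\<close>

section \<open>Binomial expectations\<close>

text \<open>
  \<open>binom_mean p n F\<close> is the expectation of \<open>F\<close> under the binomial distribution with parameters \<open>n\<close> and
  \<open>p\<close>, by conditioning on the first trial. The recursion makes it linear in \<open>F\<close> without any
  integrability side conditions.
\<close>

primrec binom_mean :: "real \<Rightarrow> nat \<Rightarrow> (nat \<Rightarrow> real) \<Rightarrow> real" where
  "binom_mean p 0 F = F 0"
| "binom_mean p (Suc n) F = p * binom_mean p n (\<lambda>k. F (Suc k)) + (1 - p) * binom_mean p n F"

lemma binom_mean_add: "binom_mean p n (\<lambda>k. F k + G k) = binom_mean p n F + binom_mean p n G"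
  by (induction n arbitrary: F G) (simp_all add: algebra_simps)

lemma binom_mean_cmult: "binom_mean p n (\<lambda>k. a * F k) = a * binom_mean p n F"
  by (induction n arbitrary: F) (simp_all add: algebra_simps)

lemma binom_mean_const [simp]: "binom_mean p n (\<lambda>_. a) = a"
  by (induction n) (simp_all add: algebra_simps)

lemma binom_mean_diff: "binom_mean p n (\<lambda>k. F k - G k) = binom_mean p n F - binom_mean p n G"
  using binom_mean_add [of p n F "\<lambda>k. - 1 * G k"] by (simp only: binom_mean_cmult) simp

lemma binom_mean_sum: "binom_mean p n (\<lambda>k. \<Sum>i\<in>A. F i k) = (\<Sum>i\<in>A. binom_mean p n (F i))"
  by (induction A rule: infinite_finite_induct) (simp_all add: binom_mean_add)

lemma binom_mean_mono:
  assumes "0 \<le> p" "p \<le> 1" "\<And>k. k \<le> n \<Longrightarrow> F k \<le> G k"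
  shows "binom_mean p n F \<le> binom_mean p n G"
  using assms(3)
proof (induction n arbitrary: F G)
  case (Suc n)
  have "binom_mean p n (\<lambda>k. F (Suc k)) \<le> binom_mean p n (\<lambda>k. G (Suc k))"
       "binom_mean p n F \<le> binom_mean p n G"
    by (intro Suc.IH Suc.prems; simp)+
  then show ?case
    using assms(1,2) by (auto intro!: add_mono mult_left_mono)
qed simp

lemma binom_mean_abs_diff_le:
  assumes "0 \<le> p" "p \<le> 1" "\<And>k. k \<le> n \<Longrightarrow> \<bar>F k - G k\<bar> \<le> H k"
  shows "\<bar>binom_mean p n F - binom_mean p n G\<bar> \<le> binom_mean p n H"
proof -
  have "binom_mean p n F \<le> binom_mean p n (\<lambda>k. G k + H k)"
       "binom_mean p n G \<le> binom_mean p n (\<lambda>k. F k + H k)"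
    using assms(3) by (intro binom_mean_mono assms(1,2); fastforce simp: abs_le_iff)+
  then show ?thesis
    by (simp add: binom_mean_add)
qed

lemma binom_mean_1 [simp]: "binom_mean 1 n F = F n"
  by (induction n arbitrary: F) simp_all

lemma binom_mean_of_bool_0: "binom_mean p n (\<lambda>k. of_bool (k = 0)) = (1 - p) ^ n"
  by (induction n) simp_all

text \<open>The identity \<open>k (n+1 choose k) = (n+1) (n choose k-1)\<close> in terms of expectations.\<close>

lemma binom_mean_shift:
  "binom_mean p (Suc n) (\<lambda>k. real k * F k) = (real n + 1) * p * binom_mean p n (\<lambda>k. F (Suc k))"
proof (induction n arbitrary: F)
  case (Suc n)
  have "binom_mean p (Suc (Suc n)) (\<lambda>k. real k * F k)
      = p * binom_mean p (Suc n) (\<lambda>k. F (Suc k) + real k * F (Suc k))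
        + (1 - p) * binom_mean p (Suc n) (\<lambda>k. real k * F k)"
    by (subst binom_mean.simps(2)) (simp only: of_nat_Suc distrib_right mult_1)
  also have "\<dots> = p * binom_mean p (Suc n) (\<lambda>k. F (Suc k))
      + (real n + 1) * p * (p * binom_mean p n (\<lambda>k. F (Suc (Suc k))) + (1 - p) * binom_mean p n (\<lambda>k. F (Suc k)))"
    unfolding binom_mean_add Suc.IH [of "\<lambda>k. F (Suc k)"] Suc.IH [of F] by (simp only: algebra_simps)
  also have "\<dots> = (real (Suc n) + 1) * p * binom_mean p (Suc n) (\<lambda>k. F (Suc k))"
    by (simp add: algebra_simps)
  finally show ?case .
qed simp

section \<open>Central moments of the binomial distribution\<close>

text \<open>The central moment of order \<open>k\<close> of a single trial, which deviates from its
  mean by \<open>1 - p\<close> or by \<open>- p\<close>.\<close>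

definition bernoulli_moment :: "real \<Rightarrow> nat \<Rightarrow> real" where
  "bernoulli_moment p k = p * (1 - p) ^ k + (1 - p) * (- p) ^ k"

definition binom_moment :: "real \<Rightarrow> nat \<Rightarrow> nat \<Rightarrow> real" where
  "binom_moment p k n = binom_mean p n (\<lambda>x. (real x - real n * p) ^ k)"

text \<open>Condition on the added trial and expand by the binomial theorem. Each closed form below
  then follows by induction on \<open>n\<close> from those of smaller order.\<close>

lemma binom_moment_Suc:
  "binom_moment p k (Suc n) =
     (\<Sum>i\<le>k. real (k choose i) * binom_moment p i n * bernoulli_moment p (k - i))"
proof -
  have *: "binom_mean p n (\<lambda>x. (real x - real n * p + a) ^ k)
      = (\<Sum>i\<le>k. real (k choose i) * binom_moment p i n * a ^ (k - i))" for a
  proof -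
    have "binom_mean p n (\<lambda>x. (real x - real n * p + a) ^ k)
        = binom_mean p n (\<lambda>x. \<Sum>i\<le>k. real (k choose i) * a ^ (k - i) * (real x - real n * p) ^ i)"
      by (simp only: binomial_ring mult_ac)
    then show ?thesis
      by (simp only: binom_mean_sum binom_mean_cmult binom_moment_def mult_ac)
  qed
  have "binom_moment p k (Suc n) = p * binom_mean p n (\<lambda>x. (real x - real n * p + (1 - p)) ^ k)
      + (1 - p) * binom_mean p n (\<lambda>x. (real x - real n * p + (- p)) ^ k)"
    by (simp add: binom_moment_def algebra_simps)
  then show ?thesis
    unfolding * bernoulli_moment_def
    by (simp add: sum_distrib_left sum.distrib [symmetric] algebra_simps)
qed

lemma bernoulli_moment_simps:
  "bernoulli_moment p 0 = 1" "bernoulli_moment p (Suc 0) = 0"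
  "bernoulli_moment p 2 = p * (1 - p)" "bernoulli_moment p 3 = p * (1 - p) * (1 - 2 * p)"
  by (simp_all add: bernoulli_moment_def algebra_simps power2_eq_square power3_eq_cube)

lemma binom_moment_0: "binom_moment p 0 n = 1"
  by (simp add: binom_moment_def)

lemma binom_moment_1: "binom_moment p (Suc 0) n = 0"
proof (induction n)
  case (Suc n) then show ?case by (simp add: binom_moment_Suc bernoulli_moment_simps)
qed (simp add: binom_moment_def)

lemma binom_moment_2: "binom_moment p 2 n = real n * bernoulli_moment p 2"
proof (induction n)
  case (Suc n)
  then show ?case
    by (subst binom_moment_Suc)
       (simp add: numeral_eq_Suc bernoulli_moment_simps binom_moment_0 binom_moment_1 algebra_simps)
qed (simp add: binom_moment_def)

lemma binom_moment_3: "binom_moment p 3 n = real n * bernoulli_moment p 3"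
proof (induction n)
  case (Suc n)
  then show ?case using binom_moment_2 [of n]
    by (subst binom_moment_Suc)
       (simp add: numeral_eq_Suc bernoulli_moment_simps binom_moment_0 binom_moment_1 algebra_simps)
qed (simp add: binom_moment_def)

text \<open>The coefficients in this and the next two orders count partitions of the factors of the
  power into blocks of size at least two, since independent centred trials kill blocks of size one:
  3 of type 2+2, 10 of type 2+3, and for order six 15 of type 2+4, 10 of type 3+3 and 15 of type
  2+2+2.\<close>

lemma binom_moment_4: "binom_moment p 4 n = real n * bernoulli_moment p 4 + 3 * (real n * (real n - 1)) * (bernoulli_moment p 2)\<^sup>2"
proof (induction n)
  case (Suc n)
  have c: "(4::nat) choose 2 = 6" "(4::nat) choose 3 = 4" by (simp_all add: numeral_eq_Suc)
  have s: "{..4::nat} = {0, Suc 0, 2, 3, 4}" by auto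
  show ?case
    by (subst binom_moment_Suc)
       (simp add: s Suc.IH c bernoulli_moment_simps(1,2) binom_moment_0 binom_moment_1 binom_moment_2 binom_moment_3 algebra_simps power2_eq_square)
qed (simp add: binom_moment_def)

lemma binom_moment_5: "binom_moment p 5 n = real n * bernoulli_moment p 5 + 10 * (real n * (real n - 1)) * bernoulli_moment p 2 * bernoulli_moment p 3"
proof (induction n)
  case (Suc n)
  have c: "(5::nat) choose 2 = 10" "(5::nat) choose 3 = 10" "(5::nat) choose 4 = 5" by (simp_all add: numeral_eq_Suc)
  have s: "{..5::nat} = {0, Suc 0, 2, 3, 4, 5}" by auto
  show ?case
    by (subst binom_moment_Suc)
       (simp add: s Suc.IH c bernoulli_moment_simps(1,2) binom_moment_0 binom_moment_1 binom_moment_2 binom_moment_3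
         binom_moment_4 algebra_simps power2_eq_square)
qed (simp add: binom_moment_def)

lemma binom_moment_6: "binom_moment p 6 n = real n * bernoulli_moment p 6
   + real n * (real n - 1) * (15 * bernoulli_moment p 2 * bernoulli_moment p 4 + 10 * (bernoulli_moment p 3)\<^sup>2)
   + 15 * (real n * (real n - 1) * (real n - 2)) * bernoulli_moment p 2 ^ 3"
proof (induction n)
  case (Suc n)
  have c: "(6::nat) choose 2 = 15" "(6::nat) choose 3 = 20" "(6::nat) choose 4 = 15" "(6::nat) choose 5 = 6"
    by (simp_all add: numeral_eq_Suc)
  have s: "{..6::nat} = {0, Suc 0, 2, 3, 4, 5, 6}" by auto
  show ?case
    by (subst binom_moment_Suc)
       (simp add: s Suc.IH c bernoulli_moment_simps(1,2) binom_moment_0 binom_moment_1 binom_moment_2 binom_moment_3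
         binom_moment_4 binom_moment_5 algebra_simps power2_eq_square power3_eq_cube)
qed (simp add: binom_moment_def)

section \<open>Taylor expansion of u ln u and its binomial mean\<close>

lemma abs_x_ln_x_le_1:
  fixes u :: real
  assumes "0 \<le> u" "u \<le> 1"
  shows "\<bar>u * ln u\<bar> \<le> 1"
proof (cases "u = 0")
  case False
  then have u: "0 < u" "u \<le> 1" using assms by auto
  have "ln (1 / u) \<le> 1 / u - 1" using u by (intro ln_le_minus_one) auto
  then have "u * - ln u \<le> u * (1 / u - 1)" using u by (intro mult_left_mono) (auto simp: ln_div)
  also have "\<dots> \<le> 1" using u by (simp add: field_simps)
  finally show ?thesis using u by (simp add: abs_mult)
qed simp

text \<open>The estimate must reach \<open>z = -1\<close>, where the derivatives blow up. Below -1/2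
  crude bounds give at most 3 on the left, and 192 * (1/2)^6 = 3. Elsewhere the Lagrange remainder
  is z^6 / (30 t^5) with t \<ge> 1/2.\<close>

lemma x_ln_x_Taylor:
  fixes z :: real
  assumes "-1 \<le> z"
  shows "\<bar>(1 + z) * ln (1 + z) - (z + z^2/2 - z^3/6 + z^4/12 - z^5/20)\<bar> \<le> 192 * z^6"
proof (cases "z < - 1/2")
  case True
  have a: "\<bar>z\<bar> \<le> 1" using assms True by auto
  then have pw: "\<bar>z ^ k\<bar> \<le> 1" for k
    by (simp add: power_abs power_le_one)
  have "\<bar>(1 + z) * ln (1 + z)\<bar> \<le> 1"
    using assms True by (intro abs_x_ln_x_le_1) auto
  moreover have "\<bar>z + z^2/2 - z^3/6 + z^4/12 - z^5/20\<bar> \<le> 2"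
    using pw [of 2] pw [of 3] pw [of 4] pw [of 5] a by linarith
  moreover have "(1/2) ^ 6 \<le> \<bar>z\<bar> ^ 6"
    using True by (intro power_mono) auto
  then have "1 / 64 \<le> z ^ 6" by (simp add: power_even_abs) (simp add: power_divide)
  ultimately show ?thesis by linarith
next
  case False
  show ?thesis
  proof (cases "z = 0")
    case z: False
    \<comment> \<open>The successive derivatives of u ln u on the positive axis.\<close>
    define D :: "nat \<Rightarrow> real \<Rightarrow> real" where
      "D k u = (if k = 0 then u * ln u else if k = 1 then ln u + 1 else
         (- 1) ^ k * fact (k - 2) / u ^ (k - 1))" for k u
    have DER: "DERIV (D k) t :> D (Suc k) t" if "t > 0" for k t
    proof -
      consider "k = 0" | "k = 1" | l where "k = Suc (Suc l)"
        by (metis One_nat_def not0_implies_Suc)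
      then show ?thesis
      proof cases
        case 1
        have "DERIV (\<lambda>u. u * ln u) t :> 1 + ln t"
          using that by (auto intro!: derivative_eq_intros)
        then show ?thesis using 1 by (simp add: D_def [abs_def] add.commute)
      next
        case 2
        have "DERIV (\<lambda>u. ln u + 1) t :> 1 / t"
          using that by (auto intro!: derivative_eq_intros)
        then show ?thesis using 2 by (simp add: D_def [abs_def])
      next
        case 3
        have "DERIV (\<lambda>u. (- 1) ^ k * fact l / u ^ Suc l) t :> (- 1) ^ Suc k * fact (Suc l) / t ^ Suc (Suc l)"
        proof -
          have "DERIV (\<lambda>u. (- 1) ^ k * fact l / u ^ Suc l) t :>
              (0 * t ^ Suc l - ((- 1) ^ k * fact l) * (real (Suc l) * t ^ (Suc l - Suc 0))) / (t ^ Suc l * t ^ Suc l)"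
            by (intro DERIV_divide DERIV_const DERIV_pow) (use that in simp)
          moreover have "(0 * t ^ Suc l - ((- 1) ^ k * fact l) * (real (Suc l) * t ^ (Suc l - Suc 0))) / (t ^ Suc l * t ^ Suc l)
              = (- 1) ^ Suc k * fact (Suc l) / t ^ Suc (Suc l)"
            using that by (simp add: divide_simps)
          ultimately show ?thesis by (rule DERIV_cong)
        qed
        then show ?thesis using 3 by (simp add: D_def [abs_def])
      qed
    qed
    \<comment> \<open>The minimum and maximum cover both signs of \<open>z\<close>; the left
      endpoint is at least 1/2, so all derivatives exist on the interval.\<close>
    have "\<exists>t. (if 1 + z < 1 then 1 + z < t \<and> t < 1 else 1 < t \<and> t < 1 + z) \<and>
        D 0 (1 + z) = (\<Sum>k<6. D k 1 / fact k * ((1 + z) - 1) ^ k) + D 6 t / fact 6 * ((1 + z) - 1) ^ 6"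
      by (rule Taylor [where a = "min 1 (1 + z)" and b = "max 1 (1 + z)"])
         (use z False DER in auto)
    then obtain t where t': "if 1 + z < 1 then 1 + z < t \<and> t < 1 else 1 < t \<and> t < 1 + z"
      and eq: "D 0 (1 + z) = (\<Sum>k<6. D k 1 / fact k * ((1 + z) - 1) ^ k) + D 6 t / fact 6 * ((1 + z) - 1) ^ 6"
      by blast
    have t: "1/2 \<le> t"
      using t' False by (auto split: if_splits)
    have "(\<Sum>k<6. D k 1 / fact k * z ^ k) = z + z^2/2 - z^3/6 + z^4/12 - z^5/20"
      by (simp add: D_def numeral_eq_Suc)
    then have "\<bar>(1 + z) * ln (1 + z) - (z + z^2/2 - z^3/6 + z^4/12 - z^5/20)\<bar> = \<bar>D 6 t / fact 6\<bar> * z ^ 6"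
      using eq by (simp add: D_def abs_mult)
    also have "\<bar>D 6 t / fact 6\<bar> = 1 / 30 * (1 / t) ^ 5"
      using t by (simp add: D_def fact_numeral power_divide)
    also have "(1 / t) ^ 5 \<le> 2 ^ 5"
      using t by (intro power_mono) (auto simp: field_simps)
    also have "1 / 30 * 2 ^ 5 * z ^ 6 \<le> 192 * z ^ 6"
      by (intro mult_right_mono) auto
    finally show ?thesis by (simp add: mult_right_mono)
  qed simp
qed

text \<open>A central moment of order k is O(n^(k/2)), so after division by (n p)^k six is the first
  even order to fall below n^-2; an even order makes the mean of the Taylor remainder a plain
  moment.\<close>

lemma binom_mean_x_ln_x:
  assumes p: "0 < p" "p \<le> 1"
  shows "\<exists>K\<ge>0. \<forall>n\<ge>1. \<bar>binom_mean p n (\<lambda>k. (k / (n * p)) * ln (k / (n * p)))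
           - ((1 - p) / (2 * p) / n + (1 - p\<^sup>2) / (12 * p\<^sup>2) / (real n)\<^sup>2)\<bar> \<le> K / real n ^ 3"
proof -
  define \<mu> where "\<mu> = bernoulli_moment p"
  \<comment> \<open>\<open>K4\<close> is the n^-3 coefficient left over from the fourth-order term;
    \<open>K5\<close> and \<open>K6\<close> bound the fifth-order term and the remainder
    entirely.\<close>
  define K4 where "K4 = (\<mu> 4 - 3 * (\<mu> 2)\<^sup>2) / (12 * p ^ 4)"
  define K5 where "K5 = (\<bar>\<mu> 5\<bar> + \<bar>10 * \<mu> 2 * \<mu> 3\<bar>) / (20 * p ^ 5)"
  define K6 where "K6 = 192 * (\<bar>\<mu> 6\<bar> + \<bar>15 * \<mu> 2 * \<mu> 4 + 10 * (\<mu> 3)\<^sup>2\<bar> + \<bar>15 * \<mu> 2 ^ 3\<bar>) / p ^ 6"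
  have "\<bar>binom_mean p n (\<lambda>k. (k / (n * p)) * ln (k / (n * p)))
           - ((1 - p) / (2 * p) / n + (1 - p\<^sup>2) / (12 * p\<^sup>2) / (real n)\<^sup>2)\<bar> \<le> (\<bar>K4\<bar> + K5 + K6) / real n ^ 3"
    if n: "n \<ge> 1" for n :: nat
  proof -
    define w where "w = n * p"
    have w: "w > 0" using n p by (simp add: w_def)
    define Z where "Z = (\<lambda>k. (real k - w) / w)"
    define T where "T = (\<lambda>k. Z k + Z k ^ 2 / 2 - Z k ^ 3 / 6 + Z k ^ 4 / 12 - Z k ^ 5 / 20)"
    have Z: "1 + Z k = k / w" "-1 \<le> Z k" for k
      using w by (simp_all add: Z_def field_simps)
    have mom: "binom_mean p n (\<lambda>k. Z k ^ j) = binom_moment p j n / w ^ j" for j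
      using binom_mean_cmult [of p n "1 / w ^ j" "\<lambda>k. (real k - w) ^ j"]
      by (simp add: Z_def power_divide binom_moment_def w_def)
    have mom': "binom_mean p n (\<lambda>k. Z k ^ j / a) = binom_moment p j n / w ^ j / a" for j a
      using binom_mean_cmult [of p n "1 / a" "\<lambda>k. Z k ^ j"] by (simp add: mom)
    have mom1: "binom_mean p n Z = 0"
      using mom [of 1] by (simp add: binom_moment_1)
    have T: "binom_mean p n T = binom_moment p 2 n / w\<^sup>2 / 2 - binom_moment p 3 n / w ^ 3 / 6
        + binom_moment p 4 n / w ^ 4 / 12 - binom_moment p 5 n / w ^ 5 / 20"
      unfolding T_def binom_mean_add binom_mean_diff mom' mom1 by simp
    have "\<bar>binom_mean p n (\<lambda>k. (k / w) * ln (k / w)) - binom_mean p n T\<bar> \<le> binom_mean p n (\<lambda>k. 192 * Z k ^ 6)"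
      by (rule binom_mean_abs_diff_le)
         (use p x_ln_x_Taylor [OF Z(2)] in \<open>auto simp: T_def Z(1) [symmetric] simp del: of_nat_mult\<close>)
    also have "\<dots> = 192 * (binom_moment p 6 n / w ^ 6)"
      by (simp add: binom_mean_cmult mom)
    also have "\<dots> \<le> K6 / real n ^ 3"
    proof -
      \<comment> \<open>In terms of \<open>r\<close> the weights of the single-trial moments are
        polynomials bounded by 1 on [0, 1], which makes the constant independent of
        \<open>n\<close>.\<close>
      define r where "r = 1 / real n"
      have r: "0 \<le> r" "r \<le> 1" using n by (auto simp: r_def)
      have "binom_moment p 6 n / w ^ 6 =
          (r\<^sup>2 * \<mu> 6 + (1 - r) * r * (15 * \<mu> 2 * \<mu> 4 + 10 * (\<mu> 3)\<^sup>2) + (1 - r) * (1 - 2 * r) * (15 * \<mu> 2 ^ 3)) / (p ^ 6 * real n ^ 3)"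
        unfolding binom_moment_6 \<mu>_def [symmetric] w_def r_def using n p
        by (simp add: divide_simps) (simp add: algebra_simps power2_eq_square power3_eq_cube eval_nat_numeral)
      also have "\<dots> \<le> (1 * \<bar>\<mu> 6\<bar> + 1 * \<bar>15 * \<mu> 2 * \<mu> 4 + 10 * (\<mu> 3)\<^sup>2\<bar> + 1 * \<bar>15 * \<mu> 2 ^ 3\<bar>) / (p ^ 6 * real n ^ 3)"
      proof (intro divide_right_mono add_mono)
        have *: "x * y \<le> 1 * \<bar>y\<bar>" if "\<bar>x\<bar> \<le> 1" for x y :: real
          using mult_right_mono [OF that, of "\<bar>y\<bar>"] abs_ge_self [of "x * y"] by (simp add: abs_mult)
        have "\<bar>r\<^sup>2\<bar> \<le> 1" using r by (simp add: power_le_one)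
        then show "r\<^sup>2 * \<mu> 6 \<le> 1 * \<bar>\<mu> 6\<bar>" by (rule *)
        have "\<bar>(1 - r) * r\<bar> \<le> 1" using r by (auto simp: abs_mult intro!: mult_le_one)
        then show "(1 - r) * r * (15 * \<mu> 2 * \<mu> 4 + 10 * (\<mu> 3)\<^sup>2) \<le> 1 * \<bar>15 * \<mu> 2 * \<mu> 4 + 10 * (\<mu> 3)\<^sup>2\<bar>" by (rule *)
        have "\<bar>(1 - r) * (1 - 2 * r)\<bar> \<le> 1" using r unfolding abs_mult by (intro mult_le_one) auto
        then show "(1 - r) * (1 - 2 * r) * (15 * \<mu> 2 ^ 3) \<le> 1 * \<bar>15 * \<mu> 2 ^ 3\<bar>" by (rule *)
      qed (use n p in auto)
      finally have "192 * (binom_moment p 6 n / w ^ 6) \<le> 192 * ((1 * \<bar>\<mu> 6\<bar> + 1 * \<bar>15 * \<mu> 2 * \<mu> 4 + 10 * (\<mu> 3)\<^sup>2\<bar> + 1 * \<bar>15 * \<mu> 2 ^ 3\<bar>) / (p ^ 6 * real n ^ 3))"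
        by (rule mult_left_mono) simp
      also have "\<dots> = K6 / real n ^ 3"
        by (simp only: K6_def divide_divide_eq_left times_divide_eq_right mult_1)
      finally show ?thesis .
    qed
    finally have 1: "\<bar>binom_mean p n (\<lambda>k. (k / w) * ln (k / w)) - binom_mean p n T\<bar> \<le> K6 / real n ^ 3" .
    have e2: "binom_moment p 2 n / w\<^sup>2 / 2 = (1 - p) / (2 * p) / n"
      using n p by (simp add: binom_moment_2 bernoulli_moment_simps w_def power2_eq_square field_simps)
    have e34: "binom_moment p 4 n / w ^ 4 / 12 - binom_moment p 3 n / w ^ 3 / 6
        = (1 - p\<^sup>2) / (12 * p\<^sup>2) / (real n)\<^sup>2 + K4 / real n ^ 3"
    proof -
      \<comment> \<open>The n^-2 coefficient: the type 2+2 part of the fourth moment, weighted 3/12,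
        against the third moment, weighted 1/6. Both share a factor (1 - p) / (12 p^2), leaving 3 (1
        - p) - 2 (1 - 2 p) = 1 + p.\<close>
      have C: "(\<mu> 2)\<^sup>2 / (4 * p ^ 4) - \<mu> 3 / (6 * p ^ 3) = (1 - p\<^sup>2) / (12 * p\<^sup>2)"
        unfolding \<mu>_def bernoulli_moment_simps using p
        by (simp add: divide_simps) (simp add: algebra_simps power2_eq_square power3_eq_cube eval_nat_numeral)
      have "binom_moment p 4 n / w ^ 4 / 12 = (\<mu> 2)\<^sup>2 / (4 * p ^ 4) / (real n)\<^sup>2 + K4 / real n ^ 3"
        unfolding binom_moment_4 \<mu>_def [symmetric] w_def K4_def using n p
        by (simp add: divide_simps) (simp add: algebra_simps power2_eq_square power3_eq_cube eval_nat_numeral)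
      moreover have "binom_moment p 3 n / w ^ 3 / 6 = \<mu> 3 / (6 * p ^ 3) / (real n)\<^sup>2"
        unfolding binom_moment_3 \<mu>_def [symmetric] w_def using n p
        by (simp add: divide_simps) (simp add: algebra_simps power2_eq_square power3_eq_cube eval_nat_numeral)
      ultimately have "binom_moment p 4 n / w ^ 4 / 12 - binom_moment p 3 n / w ^ 3 / 6
          = ((\<mu> 2)\<^sup>2 / (4 * p ^ 4) - \<mu> 3 / (6 * p ^ 3)) / (real n)\<^sup>2 + K4 / real n ^ 3"
        unfolding diff_divide_distrib by linarith
      then show ?thesis
        unfolding C .
    qed
    have e5: "\<bar>binom_moment p 5 n / w ^ 5 / 20\<bar> \<le> K5 / real n ^ 3"
    proof -
      define r where "r = 1 / real n"
      have r: "0 \<le> r" "r \<le> 1" using n by (auto simp: r_def)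
      have "binom_moment p 5 n / w ^ 5 / 20 =
          (r * \<mu> 5 + (1 - r) * (10 * \<mu> 2 * \<mu> 3)) / (20 * p ^ 5 * real n ^ 3)"
        unfolding binom_moment_5 \<mu>_def [symmetric] w_def r_def using n p
        by (simp add: divide_simps) (simp add: algebra_simps power2_eq_square power3_eq_cube eval_nat_numeral)
      also have "\<bar>\<dots>\<bar> = \<bar>r * \<mu> 5 + (1 - r) * (10 * \<mu> 2 * \<mu> 3)\<bar> / (20 * p ^ 5 * real n ^ 3)"
        using p by (simp add: abs_mult)
      also have "\<dots> \<le> (\<bar>\<mu> 5\<bar> + \<bar>10 * \<mu> 2 * \<mu> 3\<bar>) / (20 * p ^ 5 * real n ^ 3)"
      proof (intro divide_right_mono order.trans [OF abs_triangle_ineq] add_mono)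
        show "\<bar>r * \<mu> 5\<bar> \<le> \<bar>\<mu> 5\<bar>" "\<bar>(1 - r) * (10 * \<mu> 2 * \<mu> 3)\<bar> \<le> \<bar>10 * \<mu> 2 * \<mu> 3\<bar>"
          unfolding abs_mult [of r] abs_mult [of "1 - r"] using r by (intro mult_left_le_one_le; simp)+
      qed (use p in auto)
      finally show ?thesis by (simp add: K5_def field_simps)
    qed
    have e4: "\<bar>K4 / real n ^ 3\<bar> = \<bar>K4\<bar> / real n ^ 3" by simp
    have "\<bar>b - (x + y)\<bar> \<le> k4 + k5 + k6"
      if "\<bar>b - t\<bar> \<le> k6" "t = m2 - m3 + m4 - m5" "m2 = x" "m4 - m3 = y + r" "\<bar>m5\<bar> \<le> k5" "\<bar>r\<bar> = k4"
      for b x y t m2 m3 m4 m5 r k4 k5 k6 :: real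
      using that by linarith
    from this [OF 1 T e2 e34 e5 e4] show ?thesis
      by (simp only: w_def add_divide_distrib)
  qed
  moreover have "\<bar>K4\<bar> + K5 + K6 \<ge> 0" using p by (simp add: K5_def K6_def)
  ultimately show ?thesis by blast
qed

section \<open>Inverse moments\<close>

text \<open>
  Rising products instead of powers, because \<open>binom_mean_shift\<close> evaluates these in closed form.
\<close>

lemma binom_mean_inverse:
  assumes "0 < p"
  shows "binom_mean p n (\<lambda>k. 1 / (real k + 1)) = (1 - (1 - p) ^ (n + 1)) / ((real n + 1) * p)"
proof -
  have "(real n + 1) * p * binom_mean p n (\<lambda>k. 1 / real (Suc k)) = binom_mean p (Suc n) (\<lambda>k. real k * (1 / real k))"
    by (rule binom_mean_shift [symmetric])
  \<comment> \<open>Division by zero gives 0, so the summand is 1 except at \<open>k = 0\<close>;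
    this is the source of the exponentially small correction.\<close>
  also have "(\<lambda>k. real k * (1 / real k)) = (\<lambda>k. 1 - of_bool (k = 0))"
    by auto
  also have "binom_mean p (Suc n) \<dots> = 1 - (1 - p) ^ (n + 1)"
    unfolding binom_mean_diff binom_mean_of_bool_0 by simp
  finally have *: "(real n + 1) * p * binom_mean p n (\<lambda>k. 1 / (real k + 1)) = 1 - (1 - p) ^ (n + 1)"
    by (simp add: add.commute)
  have "(real n + 1) * p \<noteq> 0" using assms by (simp add: add_eq_0_iff)
  then show ?thesis
    unfolding * [symmetric] by simp
qed

lemma binom_mean_inverse_2:
  assumes "0 < p"
  shows "binom_mean p n (\<lambda>k. 1 / ((real k + 1) * (real k + 2)))
       = ((1 - (1 - p) ^ (n + 2)) / ((real n + 2) * p) - (1 - p) ^ (n + 1)) / ((real n + 1) * p)"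
proof -
  have "(real n + 1) * p * binom_mean p n (\<lambda>k. 1 / (real (Suc k) * (real (Suc k) + 1)))
      = binom_mean p (Suc n) (\<lambda>k. real k * (1 / (real k * (real k + 1))))"
    by (rule binom_mean_shift [symmetric])
  also have "(\<lambda>k. real k * (1 / (real k * (real k + 1)))) = (\<lambda>k. 1 / (real k + 1) - of_bool (k = 0))"
    by auto
  also have "binom_mean p (Suc n) \<dots> = (1 - (1 - p) ^ (n + 2)) / ((real n + 2) * p) - (1 - p) ^ (n + 1)"
    unfolding binom_mean_diff binom_mean_of_bool_0 binom_mean_inverse [OF assms] by (simp add: add.commute)
  finally have *: "(real n + 1) * p * binom_mean p n (\<lambda>k. 1 / ((real k + 1) * (real k + 2)))
      = (1 - (1 - p) ^ (n + 2)) / ((real n + 2) * p) - (1 - p) ^ (n + 1)"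
    by (simp add: add.commute add.left_commute)
  have "(real n + 1) * p \<noteq> 0" using assms by (simp add: add_eq_0_iff)
  then show ?thesis
    unfolding * [symmetric] by simp
qed

text \<open>An upper bound suffices for an error term, so the corrections from \<open>k = 0\<close>
  are simply dropped.\<close>

lemma binom_mean_inverse_3_le:
  assumes p: "0 < p" "p \<le> 1"
  shows "binom_mean p n (\<lambda>k. 1 / ((real k + 1) * (real k + 2) * (real k + 3)))
       \<le> 1 / ((real n + 1) * (real n + 2) * (real n + 3) * p ^ 3)"
proof -
  have "(real n + 1) * p * binom_mean p n (\<lambda>k. 1 / (real (Suc k) * (real (Suc k) + 1) * (real (Suc k) + 2)))
      = binom_mean p (Suc n) (\<lambda>k. real k * (1 / (real k * (real k + 1) * (real k + 2))))"
    by (rule binom_mean_shift [symmetric])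
  also have "\<dots> \<le> binom_mean p (Suc n) (\<lambda>k. 1 / ((real k + 1) * (real k + 2)))"
    using p by (intro binom_mean_mono) (auto simp: mult.assoc)
  also have "\<dots> = ((1 - (1 - p) ^ (n + 3)) / ((real n + 3) * p) - (1 - p) ^ (n + 2)) / ((real n + 2) * p)"
    using p by (subst binom_mean_inverse_2) (auto simp: add_ac eval_nat_numeral)
  also have "\<dots> \<le> (1 / ((real n + 3) * p) - 0) / ((real n + 2) * p)"
    using p by (intro divide_right_mono diff_mono) auto
  finally have "(real n + 1) * p * binom_mean p n (\<lambda>k. 1 / ((real k + 1) * (real k + 2) * (real k + 3)))
      \<le> 1 / ((real n + 3) * p * ((real n + 2) * p))"
    by (simp add: add.commute add.left_commute)
  then have "binom_mean p n (\<lambda>k. 1 / ((real k + 1) * (real k + 2) * (real k + 3)))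
      \<le> 1 / ((real n + 3) * p * ((real n + 2) * p)) / ((real n + 1) * p)"
    using p by (subst pos_le_divide_eq) (auto simp: mult.commute)
  then show ?thesis
    by (simp add: mult_ac power3_eq_cube)
qed

section \<open>Averaging an expansion in inverse powers of a binomial count\<close>

text \<open>Since 1/N - 1/(N+1) - 1/((N+1)(N+2)) = 2/(N(N+1)(N+2)), the coefficient
  \<open>\<alpha>\<close> reappears in the second place. Unlike inverse powers, the rising products
  are also meaningful at \<open>N = 0\<close>, where the hypothesis says nothing.\<close>

lemma inverse_powers_rising:
  fixes g :: "nat \<Rightarrow> real"
  assumes g: "\<And>N. N \<ge> 1 \<Longrightarrow> \<bar>g N - (\<alpha> / N + \<beta> / (real N)\<^sup>2)\<bar> \<le> K / real N ^ 3"
  shows "\<exists>L. \<forall>N. \<bar>g N - (\<alpha> * (1 / (real N + 1)) + (\<alpha> + \<beta>) * (1 / ((real N + 1) * (real N + 2))))\<bar>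
           \<le> L * (1 / ((real N + 1) * (real N + 2) * (real N + 3)))"
proof (intro exI allI)
  fix N :: nat
  \<comment> \<open>For \<open>N \<ge> 1\<close> the ratios estimated below are largest at
    \<open>N = 1\<close>, with values 8, 20 and 24. The last summand covers \<open>N = 0\<close>,
    where the rising product \<open>D\<close> equals 6.\<close>
  define L where "L = 8 * \<bar>\<alpha>\<bar> + 20 * \<bar>\<beta>\<bar> + 24 * \<bar>K\<bar> + 6 * \<bar>g 0 - (\<alpha> + (\<alpha> + \<beta>) / 2)\<bar>"
  let ?h = "\<alpha> * (1 / (real N + 1)) + (\<alpha> + \<beta>) * (1 / ((real N + 1) * (real N + 2)))"
  define D where "D = (real N + 1) * (real N + 2) * (real N + 3)"
  have D: "D > 0" by (simp add: D_def)
  have "\<bar>g N - ?h\<bar> * D \<le> L"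
  proof (cases "N = 0")
    case False
    define x where "x = real N"
    have x: "x \<ge> 1" using False by (simp add: x_def)
    have "\<alpha> / x + \<beta> / x\<^sup>2 - ?h = 2 * \<alpha> / (x * (x + 1) * (x + 2)) + \<beta> * (3 * x + 2) / (x\<^sup>2 * (x + 1) * (x + 2))"
      unfolding x_def [symmetric] using x
      by (simp add: divide_simps add_eq_0_iff) (simp add: algebra_simps power2_eq_square)
    also have "\<dots> * D = \<alpha> * (2 * (x + 3) / x) + \<beta> * ((3 * x + 2) * (x + 3) / x\<^sup>2)"
      unfolding D_def x_def [symmetric] using x
      by (simp add: divide_simps add_eq_0_iff) (simp add: algebra_simps power2_eq_square)
    finally have "\<bar>(\<alpha> / x + \<beta> / x\<^sup>2 - ?h) * D\<bar> \<le> \<bar>\<alpha>\<bar> * \<bar>2 * (x + 3) / x\<bar> + \<bar>\<beta>\<bar> * \<bar>(3 * x + 2) * (x + 3) / x\<^sup>2\<bar>"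
      using abs_triangle_ineq by (simp only: abs_mult [symmetric])
    also have "\<dots> \<le> \<bar>\<alpha>\<bar> * 8 + \<bar>\<beta>\<bar> * 20"
    proof (intro add_mono mult_left_mono)
      show "\<bar>2 * (x + 3) / x\<bar> \<le> 8" using x by (simp add: field_simps)
      have "(3 * x + 2) * (x + 3) \<le> (5 * x) * (4 * x)" using x by (intro mult_mono) auto
      then show "\<bar>(3 * x + 2) * (x + 3) / x\<^sup>2\<bar> \<le> 20" using x by (simp add: field_simps power2_eq_square)
    qed auto
    finally have 1: "\<bar>\<alpha> / x + \<beta> / x\<^sup>2 - ?h\<bar> * D \<le> \<bar>\<alpha>\<bar> * 8 + \<bar>\<beta>\<bar> * 20"
      using D by (simp add: abs_mult)
    have "\<bar>g N - (\<alpha> / x + \<beta> / x\<^sup>2)\<bar> * D \<le> K / x ^ 3 * D"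
      using g [of N] False D by (intro mult_right_mono) (auto simp: x_def)
    also have "\<dots> \<le> \<bar>K\<bar> / x ^ 3 * D"
      using D x by (intro mult_right_mono divide_right_mono) auto
    also have "\<dots> \<le> \<bar>K\<bar> / x ^ 3 * (24 * x ^ 3)"
    proof (intro mult_left_mono)
      have "D \<le> (2 * x) * (3 * x) * (4 * x)"
        unfolding D_def x_def [symmetric] using x by (intro mult_mono) auto
      then show "D \<le> 24 * x ^ 3" by (simp add: power3_eq_cube)
    qed (use x in auto)
    also have "\<dots> = \<bar>K\<bar> * 24" using x by simp
    finally have 2: "\<bar>g N - (\<alpha> / x + \<beta> / x\<^sup>2)\<bar> * D \<le> \<bar>K\<bar> * 24" .
    have "\<bar>g N - ?h\<bar> * D \<le> (\<bar>g N - (\<alpha> / x + \<beta> / x\<^sup>2)\<bar> + \<bar>\<alpha> / x + \<beta> / x\<^sup>2 - ?h\<bar>) * D"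
      using D by (intro mult_right_mono) auto
    also have "\<dots> = \<bar>g N - (\<alpha> / x + \<beta> / x\<^sup>2)\<bar> * D + \<bar>\<alpha> / x + \<beta> / x\<^sup>2 - ?h\<bar> * D"
      by (rule distrib_right)
    also have "\<dots> \<le> \<bar>K\<bar> * 24 + (\<bar>\<alpha>\<bar> * 8 + \<bar>\<beta>\<bar> * 20)"
      by (intro add_mono 1 2)
    also have "\<dots> \<le> L"
      by (simp add: L_def)
    finally show ?thesis .
  qed (simp add: D_def L_def)
  then show "\<bar>g N - ?h\<bar> \<le> L * (1 / ((real N + 1) * (real N + 2) * (real N + 3)))"
    using D unfolding D_def [symmetric] by (simp add: field_simps)
qed

text \<open>Up to o(n^-2), the mean of 1/(N+1) is 1/(c n) - 1/(c n^2) and that of 1/((N+1)(N+2)) is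
  1/(c^2 n^2). Hence \<open>\<alpha>\<close> contributes \<alpha>/c^2 - \<alpha>/c = \<alpha> (1 -
  c)/c^2 at second order.\<close>

lemma binom_mean_expansion:
  fixes g :: "nat \<Rightarrow> real"
  assumes c: "0 < c" "c \<le> 1"
    and g: "\<And>N. N \<ge> 1 \<Longrightarrow> \<bar>g N - (\<alpha> / N + \<beta> / (real N)\<^sup>2)\<bar> \<le> K / real N ^ 3"
  shows "(\<lambda>n. binom_mean c n g - (\<alpha> / c / n + (\<alpha> * (1 - c) + \<beta>) / c\<^sup>2 / (real n)\<^sup>2)) \<in> o(\<lambda>n. 1 / (real n)\<^sup>2)"
\<comment> \<open>For \<open>c = 1\<close>, the situation of the full model, \<open>N = n\<close> is
  deterministic. Otherwise \<open>0 < 1 - c < 1\<close> and its powers decay exponentially.\<close>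
proof (cases "c = 1")
  case True
  have "(\<lambda>n. g n - (\<alpha> / n + \<beta> / (real n)\<^sup>2)) \<in> O(\<lambda>n. 1 / real n ^ 3)"
    using g by (intro bigoI [where c = K] eventually_sequentiallyI [where c = 1]) auto
  also have "(\<lambda>n. 1 / real n ^ 3) \<in> o(\<lambda>n. 1 / (real n)\<^sup>2)"
    by real_asymp
  finally show ?thesis
    by (simp add: True)
next
  case False
  then have c: "0 < c" "c < 1" using c by auto
  let ?A = "\<lambda>n. binom_mean c n (\<lambda>k. 1 / (real k + 1))"
  let ?B = "\<lambda>n. binom_mean c n (\<lambda>k. 1 / ((real k + 1) * (real k + 2)))"
  obtain L where L: "\<And>N. \<bar>g N - (\<alpha> * (1 / (real N + 1)) + (\<alpha> + \<beta>) * (1 / ((real N + 1) * (real N + 2))))\<bar>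
           \<le> L * (1 / ((real N + 1) * (real N + 2) * (real N + 3)))"
    using inverse_powers_rising [OF g] by blast
  have L0: "L \<ge> 0"
    using order.trans [OF abs_ge_zero L [of 0]] by simp
  have "\<bar>binom_mean c n g - (\<alpha> * ?A n + (\<alpha> + \<beta>) * ?B n)\<bar> \<le> L / c ^ 3 * \<bar>1 / ((real n + 1) * (real n + 2) * (real n + 3))\<bar>" for n
  proof -
    have "\<bar>binom_mean c n g - (\<alpha> * ?A n + (\<alpha> + \<beta>) * ?B n)\<bar>
        \<le> L * binom_mean c n (\<lambda>k. 1 / ((real k + 1) * (real k + 2) * (real k + 3)))"
      unfolding binom_mean_cmult [symmetric] binom_mean_add [symmetric]
      using c L by (intro binom_mean_abs_diff_le) auto
    also have "\<dots> \<le> L * (1 / ((real n + 1) * (real n + 2) * (real n + 3) * c ^ 3))"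
      using c L0 by (intro mult_left_mono binom_mean_inverse_3_le) auto
    finally show ?thesis
      by (simp add: mult_ac)
  qed
  then have "(\<lambda>n. binom_mean c n g - (\<alpha> * ?A n + (\<alpha> + \<beta>) * ?B n)) \<in> O(\<lambda>n. 1 / ((real n + 1) * (real n + 2) * (real n + 3)))"
    by (intro bigoI [where c = "L / c ^ 3"]) auto
  also have "(\<lambda>n. 1 / ((real n + 1) * (real n + 2) * (real n + 3))) \<in> o(\<lambda>n. 1 / (real n)\<^sup>2)"
    by real_asymp
  finally have 1: "(\<lambda>n. binom_mean c n g - (\<alpha> * ?A n + (\<alpha> + \<beta>) * ?B n)) \<in> o(\<lambda>n. 1 / (real n)\<^sup>2)" .
  have A: "(\<lambda>n. ?A n - (1 / (c * n) - 1 / (c * (real n)\<^sup>2))) \<in> o(\<lambda>n. 1 / (real n)\<^sup>2)"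
    unfolding binom_mean_inverse [OF c(1)] using c by real_asymp
  have B: "(\<lambda>n. ?B n - 1 / (c\<^sup>2 * (real n)\<^sup>2)) \<in> o(\<lambda>n. 1 / (real n)\<^sup>2)"
  proof -
    \<comment> \<open>Separates the rational part, which is O(n^-3), from the terms carrying powers
      of \<open>1 - c\<close>.\<close>
    have "?B n - 1 / (c\<^sup>2 * (real n)\<^sup>2) = 1 / c\<^sup>2 * (1 / ((real n + 1) * (real n + 2)) - 1 / (real n)\<^sup>2
        - (1 - c) ^ (n + 2) / ((real n + 1) * (real n + 2)) - c * (1 - c) ^ (n + 1) / (real n + 1))" for n
    proof -
      have "((1 - y) / (v * c) - x) / (u * c) - 1 / (c\<^sup>2 * w) = 1 / c\<^sup>2 * (1 / (u * v) - 1 / w - y / (u * v) - c * x / u)"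
        if "u \<noteq> 0" "v \<noteq> 0" for u v w x y
        using that c by (cases "w = 0") (simp_all add: field_simps power2_eq_square)
      then show ?thesis
        unfolding binom_mean_inverse_2 [OF c(1)] by (simp add: add_eq_0_iff)
    qed
    moreover have "(\<lambda>n. 1 / ((real n + 1) * (real n + 2)) - 1 / (real n)\<^sup>2
        - (1 - c) ^ (n + 2) / ((real n + 1) * (real n + 2)) - c * (1 - c) ^ (n + 1) / (real n + 1))
        \<in> o(\<lambda>n. 1 / (real n)\<^sup>2)"
      using c by real_asymp
    ultimately show ?thesis
      by (simp only: cmult_in_smallo_iff) simp
  qed
  have 2: "(\<lambda>n. \<alpha> * (?A n - (1 / (c * n) - 1 / (c * (real n)\<^sup>2))) + (\<alpha> + \<beta>) * (?B n - 1 / (c\<^sup>2 * (real n)\<^sup>2)))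
      \<in> o(\<lambda>n. 1 / (real n)\<^sup>2)"
    by (intro sum_in_smallo; simp only: cmult_in_smallo_iff A B simp_thms)
  have "x - (\<alpha> * a + \<gamma> * b) + (\<alpha> * (a - a') + \<gamma> * (b - b')) = x - (\<alpha> * a' + \<gamma> * b')" for x a b a' b' \<gamma> :: real
    by (simp add: algebra_simps)
  moreover have "\<alpha> * (1 / (c * n) - 1 / (c * (real n)\<^sup>2)) + (\<alpha> + \<beta>) * (1 / (c\<^sup>2 * (real n)\<^sup>2))
      = \<alpha> / c / n + (\<alpha> * (1 - c) + \<beta>) / c\<^sup>2 / (real n)\<^sup>2" for n
    using c by (cases "n = 0") (simp_all add: field_simps power2_eq_square)
  ultimately show ?thesis
    using sum_in_smallo(1) [OF 1 2] by (simp only:)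
qed

text \<open>Multiplying the difference of the expansions by n^2 shows that
  \<open>d1 * n + d2\<close> tends to 0, which forces both to vanish. This identifies arbitrarily
  given coefficients with computed ones.\<close>

lemma expansion_coefficients_unique:
  fixes f :: "nat \<Rightarrow> real"
  assumes "(\<lambda>n. f n - (a\<^sub>1 / n + a\<^sub>2 / (real n)\<^sup>2)) \<in> o(\<lambda>n. 1 / (real n)\<^sup>2)"
    and "(\<lambda>n. f n - (b\<^sub>1 / n + b\<^sub>2 / (real n)\<^sup>2)) \<in> o(\<lambda>n. 1 / (real n)\<^sup>2)"
  shows "a\<^sub>1 = b\<^sub>1" "a\<^sub>2 = b\<^sub>2"
proof -
  define d1 d2 where "d1 = b\<^sub>1 - a\<^sub>1" and "d2 = b\<^sub>2 - a\<^sub>2"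
  have "(\<lambda>n. (f n - (a\<^sub>1 / n + a\<^sub>2 / (real n)\<^sup>2)) - (f n - (b\<^sub>1 / n + b\<^sub>2 / (real n)\<^sup>2))) \<in> o(\<lambda>n. 1 / (real n)\<^sup>2)"
    using assms by (rule sum_in_smallo)
  then have "(\<lambda>n. ((f n - (a\<^sub>1 / n + a\<^sub>2 / (real n)\<^sup>2)) - (f n - (b\<^sub>1 / n + b\<^sub>2 / (real n)\<^sup>2))) / (1 / (real n)\<^sup>2)) \<longlonglongrightarrow> 0"
    by (rule smalloD_tendsto)
  moreover have "eventually (\<lambda>n. ((f n - (a\<^sub>1 / n + a\<^sub>2 / (real n)\<^sup>2)) - (f n - (b\<^sub>1 / n + b\<^sub>2 / (real n)\<^sup>2))) / (1 / (real n)\<^sup>2)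
      = d1 * n + d2) sequentially"
    using eventually_gt_at_top [of 0]
    by eventually_elim (simp add: d1_def d2_def field_simps power2_eq_square)
  ultimately have lim: "(\<lambda>n. d1 * real n + d2) \<longlonglongrightarrow> 0"
    by (rule Lim_transform_eventually)
  have "(\<lambda>n. (d1 * real n + d2) * (1 / n)) \<longlonglongrightarrow> 0 * 0"
    by (intro tendsto_mult lim lim_1_over_n)
  moreover have "(\<lambda>n. (d1 * real n + d2) * (1 / n)) \<longlonglongrightarrow> d1"
    by real_asymp
  ultimately have d1: "d1 = 0"
    using LIMSEQ_unique by fastforce
  then show "a\<^sub>1 = b\<^sub>1" by (simp add: d1_def)
  show "a\<^sub>2 = b\<^sub>2"
    using lim d1 by (simp add: d2_def LIMSEQ_const_iff)
qed

section \<open>Multinomial expectations and the risks\<close>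

lemma multinomial_pmf_0: "multinomial_pmf I J \<theta> 0 = return_pmf (\<lambda>_ _. 0)"
proof -
  have "counts 0 f = (\<lambda>_ _. 0)" for f
    by (simp add: counts_def fun_eq_iff)
  then show ?thesis by (simp add: multinomial_pmf_def)
qed

text \<open>Independence splits off the trial with index \<open>n\<close>; this mirrors the
  recursion of \<open>binom_mean\<close>.\<close>

lemma multinomial_pmf_Suc:
  "multinomial_pmf I J \<theta> (Suc n) =
     trial_pmf I J \<theta> \<bind> (\<lambda>y. map_pmf (\<lambda>x i j. x i j + of_bool (y = (i, j))) (multinomial_pmf I J \<theta> n))"
proof -
  have c: "counts (Suc n) (f(n := y)) = (\<lambda>i j. counts n f i j + of_bool (y = (i, j)))" for f y
  proof (intro ext)
    fix i j
    have "{k. k < Suc n \<and> (f(n := y)) k = (i, j)} = {k. k < n \<and> f k = (i, j)} \<union> (if y = (i, j) then {n} else {})"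
      by (auto simp: less_Suc_eq)
    then show "counts (Suc n) (f(n := y)) i j = counts n f i j + of_bool (y = (i, j))"
      by (simp add: counts_def)
  qed
  show ?thesis
    unfolding multinomial_pmf_def lessThan_Suc
    by (subst Pi_pmf_insert') (simp_all add: map_pmf_def bind_assoc_pmf bind_return_pmf c)
qed

lemma finite_set_multinomial_pmf:
  "\<theta> \<in> full_model I J \<Longrightarrow> finite (set_pmf (multinomial_pmf I J \<theta> n))"
  by (induction n)
     (auto simp: multinomial_pmf_0 multinomial_pmf_Suc intro!: finite_UN_I finite_subset [OF set_pmf_trial_pmf])

text \<open>The count of \<open>S\<close> is binomial, and given it the count of the subset
  \<open>T\<close> is binomial with the conditional probability. Induction over all \<open>F\<close>
  at once yields this without conditional distributions.\<close>

lemma expectation_multinomial_pmf: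
  assumes \<theta>: "\<theta> \<in> full_model I J" and TS: "T \<subseteq> S" "S \<subseteq> cells I J"
  defines "w \<equiv> \<lambda>A. \<Sum>a\<in>A. case_prod \<theta> a"
  assumes pos: "0 < w S"
  shows "measure_pmf.expectation (multinomial_pmf I J \<theta> n)
           (\<lambda>x. F (\<Sum>a\<in>T. case_prod x a) (\<Sum>a\<in>S. case_prod x a))
       = binom_mean (w S) n (\<lambda>N. binom_mean (w T / w S) N (\<lambda>k. F k N))"
proof (induction n arbitrary: F)
  case 0
  show ?case by (simp add: multinomial_pmf_0 case_prod_unfold)
next
  case (Suc n)
  let ?E = "\<lambda>F. measure_pmf.expectation (multinomial_pmf I J \<theta> n)
           (\<lambda>x. F (\<Sum>a\<in>T. case_prod x a) (\<Sum>a\<in>S. case_prod x a))"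
  have fin: "finite S" "finite T"
    using TS finite_subset [OF _ finite_cells [of I J]] by blast+
  have add: "(\<Sum>a\<in>A. (case a of (i, j) \<Rightarrow> x i j + of_bool (y = (i, j)))) = (\<Sum>a\<in>A. case_prod x a) + of_bool (y \<in> A)"
    if "finite A" for A y and x :: "nat \<Rightarrow> nat \<Rightarrow> nat"
  proof -
    have "(\<Sum>a\<in>A. (case a of (i, j) \<Rightarrow> x i j + of_bool (y = (i, j)))) = (\<Sum>a\<in>A. case_prod x a + (if a = y then 1 else 0))"
      by (intro sum.cong) (auto split: prod.splits)
    then show ?thesis
      using that by (simp add: sum.distrib)
  qed
  have "measure_pmf.expectation (multinomial_pmf I J \<theta> (Suc n))
           (\<lambda>x. F (\<Sum>a\<in>T. case_prod x a) (\<Sum>a\<in>S. case_prod x a))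
      = (\<Sum>y\<in>cells I J. case_prod \<theta> y * ?E (\<lambda>k N. F (k + of_bool (y \<in> T)) (N + of_bool (y \<in> S))))"
    unfolding multinomial_pmf_Suc
    by (subst pmf_expectation_bind [of "cells I J"])
       (use \<theta> fin in \<open>auto simp: finite_set_multinomial_pmf set_pmf_trial_pmf pmf_trial_pmf add intro!: sum.cong\<close>)
  \<comment> \<open>The new trial falls into \<open>T\<close>, into \<open>S\<close> but not
    \<open>T\<close>, or outside \<open>S\<close>.\<close>
  also have "\<dots> = (\<Sum>y\<in>cells I J. case_prod \<theta> y * of_bool (y \<in> T) * ?E (\<lambda>k N. F (Suc k) (Suc N))
      + (case_prod \<theta> y * of_bool (y \<in> S) - case_prod \<theta> y * of_bool (y \<in> T)) * ?E (\<lambda>k N. F k (Suc N))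
      + (case_prod \<theta> y - case_prod \<theta> y * of_bool (y \<in> S)) * ?E F)"
    using TS by (intro sum.cong) (auto simp: of_bool_def)
  also have "\<dots> = w T * ?E (\<lambda>k N. F (Suc k) (Suc N)) + (w S - w T) * ?E (\<lambda>k N. F k (Suc N)) + (1 - w S) * ?E F"
  proof -
    have "(\<Sum>y\<in>cells I J. case_prod \<theta> y * of_bool (y \<in> A)) = w A" if "A \<subseteq> cells I J" for A
      unfolding w_def using that by (intro sum.mono_neutral_cong_right) auto
    moreover have "(\<Sum>y\<in>cells I J. case_prod \<theta> y) = 1"
      using \<theta> by (simp add: full_model_def)
    ultimately show ?thesis
      unfolding sum.distrib sum_subtractf sum_distrib_right [symmetric] using TS by simp
  qed
  also have "\<dots> = w S * binom_mean (w S) n (\<lambda>N. binom_mean (w T / w S) (Suc N) (\<lambda>k. F k (Suc N)))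
      + (1 - w S) * binom_mean (w S) n (\<lambda>N. binom_mean (w T / w S) N (\<lambda>k. F k N))"
    unfolding Suc.IH [of F] Suc.IH [of "\<lambda>k N. F (Suc k) (Suc N)"] Suc.IH [of "\<lambda>k N. F k (Suc N)"] binom_mean.simps(2) binom_mean_add binom_mean_cmult
    using pos by (simp add: field_simps)
  finally show ?case by simp
qed

section \<open>The cost of discarding samples with an empty group\<close>

text \<open>With \<open>a\<close>, \<open>b\<close> the contributions of \<open>A\<close> and its
  complement and \<open>P\<close>, \<open>Q\<close> their probabilities, a/P - (a + b) = a Q/P - b,
  and both terms are at most B Q in absolute value.\<close>

lemma expectation_cond_pmf_diff_le:
  fixes f :: "'a \<Rightarrow> real"
  assumes fin: "finite (set_pmf p)" and ne: "set_pmf p \<inter> A \<noteq> {}"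
    and B: "\<And>x. x \<in> set_pmf p \<Longrightarrow> \<bar>f x\<bar> \<le> B"
  shows "\<bar>measure_pmf.expectation (cond_pmf p A) f - measure_pmf.expectation p f\<bar>
       \<le> 2 * B * measure_pmf.prob p (- A)"
proof -
  let ?S = "set_pmf p"
  define a where "a = (\<Sum>x\<in>?S \<inter> A. pmf p x * f x)"
  define b where "b = (\<Sum>x\<in>?S - A. pmf p x * f x)"
  define P where "P = (\<Sum>x\<in>?S \<inter> A. pmf p x)"
  define Q where "Q = (\<Sum>x\<in>?S - A. pmf p x)"
  have un: "?S = (?S \<inter> A) \<union> (?S - A)" by auto
  have ab: "measure_pmf.expectation p f = a + b"
    unfolding a_def b_def
    by (subst integral_measure_pmf_real [OF fin], simp, subst un, subst sum.union_disjoint)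
       (use fin in \<open>auto simp: mult.commute\<close>)
  have "P + Q = (\<Sum>x\<in>?S. pmf p x)"
    unfolding P_def Q_def by (subst un, subst sum.union_disjoint) (use fin in auto)
  then have PQ: "Q = 1 - P"
    using sum_pmf_eq_1 [OF fin] by simp
  have prob: "measure_pmf.prob p X = (\<Sum>x\<in>?S \<inter> X. pmf p x)" for X
    using measure_measure_pmf_finite [of "?S \<inter> X" p] fin measure_Int_set_pmf [of p X] by (simp add: Int_commute)
  have P: "measure_pmf.prob p A = P" and Q: "measure_pmf.prob p (- A) = Q"
    by (auto simp: prob P_def Q_def Diff_eq)
  have P0: "P > 0"
    using ne measure_pmf_posI [of _ p A] by (auto simp: P)
  have "measure_pmf.expectation (cond_pmf p A) f = a / P"
    unfolding a_def sum_divide_distrib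
    by (subst integral_measure_pmf_real [of "?S \<inter> A"])
       (use fin ne in \<open>auto simp: pmf_cond P intro!: sum.cong\<close>)
  then have "measure_pmf.expectation (cond_pmf p A) f - measure_pmf.expectation p f = a / P * Q - b"
    using P0 unfolding ab PQ by (simp add: right_diff_distrib)
  also have "\<bar>\<dots>\<bar> \<le> \<bar>a\<bar> / P * Q + \<bar>b\<bar>"
    using P0 by (intro order.trans [OF abs_triangle_ineq4]) (simp add: abs_mult Q_def sum_nonneg)
  also have "\<bar>a\<bar> \<le> (\<Sum>x\<in>?S \<inter> A. pmf p x * B)"
    unfolding a_def by (intro order.trans [OF sum_abs] sum_mono) (auto simp: abs_mult intro!: mult_left_mono B)
  also have "\<bar>b\<bar> \<le> (\<Sum>x\<in>?S - A. pmf p x * B)"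
    unfolding b_def by (intro order.trans [OF sum_abs] sum_mono) (auto simp: abs_mult intro!: mult_left_mono B)
  finally show ?thesis
    using P0 unfolding sum_distrib_right [symmetric] P_def [symmetric] Q_def [symmetric] Q
    by (simp add: divide_right_mono mult_right_mono Q_def sum_nonneg algebra_simps)
qed

text \<open>Bounds the divergence uniformly over samples, so that discarding rare ones is
  harmless.\<close>

lemma abs_x_ln_x_div_le:
  fixes u q :: real
  assumes u: "0 \<le> u" "u \<le> 1" and q: "0 < q"
  shows "\<bar>u * ln (u / q)\<bar> \<le> 1 + \<bar>ln q\<bar>"
proof (cases "u = 0")
  case False
  then have u: "0 < u" "u \<le> 1" using u by auto
  have "\<bar>u * ln u\<bar> \<le> 1" using u by (intro abs_x_ln_x_le_1) auto
  moreover have "\<bar>u * ln q\<bar> \<le> \<bar>ln q\<bar>"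
    using u by (simp add: abs_mult mult_left_le_one_le)
  moreover have "u * ln (u / q) = u * ln u - u * ln q"
    using u q by (simp add: ln_div right_diff_distrib)
  ultimately show ?thesis by linarith
qed simp

definition group :: "nat \<Rightarrow> (nat \<Rightarrow> nat) \<Rightarrow> nat \<Rightarrow> (nat \<times> nat) set" where
  "group I J i = {i} \<times> {1..J i}"

lemma sum_group: "(\<Sum>a\<in>group I J i. f a) = (\<Sum>j = 1..J i. f (i, j))"
  unfolding group_def by (simp add: sum.cartesian_product')

lemma group_subset_cells: "i \<in> {1..I} \<Longrightarrow> group I J i \<subseteq> cells I J"
  by (auto simp: group_def cells_def)

text \<open>A union bound: each group count is binomial and vanishes with the stated power.\<close>

lemma prob_empty_group_le:
  assumes \<theta>: "\<theta> \<in> full_model I J" and pos: "\<And>i. i \<in> {1..I} \<Longrightarrow> 0 < (\<Sum>j = 1..J i. \<theta> i j)"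
  shows "measure_pmf.prob (multinomial_pmf I J \<theta> n) (- no_empty_group I J)
       \<le> (\<Sum>i = 1..I. (1 - (\<Sum>j = 1..J i. \<theta> i j)) ^ n)"
proof -
  let ?M = "multinomial_pmf I J \<theta> n"
  have "- no_empty_group I J = (\<Union>i\<in>{1..I}. {x. (\<Sum>j = 1..J i. x i j) = 0})"
    by (auto simp: no_empty_group_def)
  then have "measure_pmf.prob ?M (- no_empty_group I J)
      \<le> (\<Sum>i = 1..I. measure_pmf.prob ?M {x. (\<Sum>j = 1..J i. x i j) = 0})"
    by (simp only:) (intro measure_pmf.finite_measure_subadditive_finite; simp)
  also have "\<dots> = (\<Sum>i = 1..I. (1 - (\<Sum>j = 1..J i. \<theta> i j)) ^ n)"
  proof (intro sum.cong refl)
    fix i assume i: "i \<in> {1..I}"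
    have "measure_pmf.prob ?M {x. (\<Sum>j = 1..J i. x i j) = 0}
        = measure_pmf.expectation ?M (indicator {x. (\<Sum>j = 1..J i. x i j) = 0})"
      by simp
    also have "indicator {x. (\<Sum>j = 1..J i. x i j) = 0}
        = (\<lambda>x. of_bool ((\<Sum>a\<in>group I J i. case_prod x a) = 0) :: real)"
      by (auto simp: indicator_def sum_group)
    also have "measure_pmf.expectation ?M \<dots> = (1 - (\<Sum>a\<in>group I J i. case_prod \<theta> a)) ^ n"
      by (subst expectation_multinomial_pmf [OF \<theta> order_refl group_subset_cells [OF i], where F = "\<lambda>k N. of_bool (N = 0)"])
         (use pos [OF i] in \<open>auto simp: sum_group binom_mean_of_bool_0\<close>)
    finally show "measure_pmf.prob ?M {x. (\<Sum>j = 1..J i. x i j) = 0} = (1 - (\<Sum>j = 1..J i. \<theta> i j)) ^ n"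
      by (simp add: sum_group)
  qed
  finally show ?thesis .
qed

section \<open>Expansion of both risks\<close>

text \<open>Treats both models at once: \<open>G a\<close> is the set of cells within which the
  frequency of \<open>a\<close> is taken. The strict bounds on the group probabilities make
  discarded samples exponentially rare.\<close>

lemma risk_expansion:
  assumes m: "m \<in> full_model I J" and mpos: "\<And>i j. (i, j) \<in> cells I J \<Longrightarrow> 0 < m i j"
    and c: "\<And>i. i \<in> {1..I} \<Longrightarrow> 0 < (\<Sum>j = 1..J i. m i j) \<and> (\<Sum>j = 1..J i. m i j) < 1"
    and G: "\<And>a. a \<in> cells I J \<Longrightarrow> a \<in> G a \<and> G a \<subseteq> cells I J"
  defines "w \<equiv> \<lambda>a. \<Sum>b\<in>G a. case_prod m b"
  defines "q \<equiv> \<lambda>a. case_prod m a / w a"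
  assumes est: "\<And>n x i j. n > 0 \<Longrightarrow> x \<in> set_pmf (multinomial_pmf I J m n) \<Longrightarrow> x \<in> no_empty_group I J \<Longrightarrow>
      (i, j) \<in> cells I J \<Longrightarrow> est n x i j = w (i, j) * real (x i j) / real (\<Sum>b\<in>G (i, j). case_prod x b)"
  shows "(\<lambda>n. risk I J m n (est n) - ((\<Sum>a\<in>cells I J. (1 - q a) / 2) / n
     + (\<Sum>a\<in>cells I J. (1 - q a) * (1 - w a) / (2 * w a) + (1 / q a - q a) / (12 * w a)) / (real n)\<^sup>2))
     \<in> o(\<lambda>n. 1 / (real n)\<^sup>2)"
proof -
  let ?M = "multinomial_pmf I J m"
  let ?A = "no_empty_group I J"
  define \<phi> where "\<phi> = (\<lambda>a k N. case_prod m a * (real k / (real N * q a) * ln (real k / (real N * q a))))"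
  define X where "X = (\<lambda>(x :: nat \<Rightarrow> nat \<Rightarrow> nat) S. \<Sum>b\<in>S. case_prod x b)"
  \<comment> \<open>Extends the divergence to all samples: a cell with empty \<open>G a\<close>
    contributes 0 by division by zero. Unconditional means of \<open>D\<close> can then be computed
    first.\<close>
  define D where "D = (\<lambda>x. \<Sum>a\<in>cells I J. \<phi> a (X x {a}) (X x (G a)))"
  have mpos: "case_prod m a > 0" if "a \<in> cells I J" for a
    using mpos that by (cases a) auto
  have finG: "finite (G a)" if "a \<in> cells I J" for a
    using G [OF that] finite_subset [OF _ finite_cells] by blast
  have mw: "case_prod m a \<le> w a" if "a \<in> cells I J" for a
    unfolding w_def using G [OF that] finG [OF that] mpos
    by (intro member_le_sum) (auto intro: less_imp_le)
  have w: "0 < w a" "w a \<le> 1" if "a \<in> cells I J" for a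
  proof -
    show "0 < w a" using mpos [OF that] mw [OF that] by linarith
    have "w a \<le> (\<Sum>b\<in>cells I J. case_prod m b)"
      unfolding w_def using G [OF that] mpos by (intro sum_mono2) (auto intro: less_imp_le)
    also have "\<dots> = 1" using m by (simp add: full_model_def)
    finally show "w a \<le> 1" .
  qed
  have q: "0 < q a" "q a \<le> 1" if "a \<in> cells I J" for a
    using mpos [OF that] mw [OF that] w [OF that] by (simp_all add: q_def)
  have mq: "case_prod m a = w a * q a" if "a \<in> cells I J" for a
    using w [OF that] by (simp add: q_def)

  have D_expansion: "(\<lambda>n. measure_pmf.expectation (?M n) D
     - ((\<Sum>a\<in>cells I J. (1 - q a) / 2) / n
     + (\<Sum>a\<in>cells I J. (1 - q a) * (1 - w a) / (2 * w a) + (1 / q a - q a) / (12 * w a)) / (real n)\<^sup>2))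
     \<in> o(\<lambda>n. 1 / (real n)\<^sup>2)"
  proof -
    define g where "g = (\<lambda>a N. binom_mean (q a) N (\<lambda>k. real k / (real N * q a) * ln (real k / (real N * q a))))"
    have E: "measure_pmf.expectation (?M n) D = (\<Sum>a\<in>cells I J. case_prod m a * binom_mean (w a) n (g a))" for n
    proof -
      have "measure_pmf.expectation (?M n) D
          = (\<Sum>a\<in>cells I J. measure_pmf.expectation (?M n) (\<lambda>x. \<phi> a (X x {a}) (X x (G a))))"
        unfolding D_def
        by (intro Bochner_Integration.integral_sum integrable_measure_pmf_finite finite_set_multinomial_pmf m)
      also have "\<dots> = (\<Sum>a\<in>cells I J. case_prod m a * binom_mean (w a) n (g a))"
      proof (intro sum.cong refl)
        fix a assume a: "a \<in> cells I J"
        have "measure_pmf.expectation (?M n) (\<lambda>x. \<phi> a (X x {a}) (X x (G a)))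
            = binom_mean (w a) n (\<lambda>N. binom_mean (q a) N (\<lambda>k. \<phi> a k N))"
          unfolding X_def
          by (subst expectation_multinomial_pmf [OF m])
             (use G [OF a] w [OF a] in \<open>auto simp: w_def q_def\<close>)
        then show "measure_pmf.expectation (?M n) (\<lambda>x. \<phi> a (X x {a}) (X x (G a)))
            = case_prod m a * binom_mean (w a) n (g a)"
          by (simp only: \<phi>_def g_def binom_mean_cmult)
      qed
      finally show ?thesis .
    qed
    \<comment> \<open>The coefficients of \<open>binom_mean_x_ln_x\<close> at success probability
      \<open>q a\<close>.\<close>
    define \<alpha> where "\<alpha> = (\<lambda>a. (1 - q a) / (2 * q a))"
    define \<beta> where "\<beta> = (\<lambda>a. (1 - (q a)\<^sup>2) / (12 * (q a)\<^sup>2))"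
    have "(\<lambda>n. binom_mean (w a) n (g a) - (\<alpha> a / w a / n + (\<alpha> a * (1 - w a) + \<beta> a) / (w a)\<^sup>2 / (real n)\<^sup>2))
        \<in> o(\<lambda>n. 1 / (real n)\<^sup>2)" if a: "a \<in> cells I J" for a
    proof -
      obtain K where "\<forall>N\<ge>1. \<bar>g a N - (\<alpha> a / N + \<beta> a / (real N)\<^sup>2)\<bar> \<le> K / real N ^ 3"
        using binom_mean_x_ln_x [OF q [OF a]] unfolding g_def \<alpha>_def \<beta>_def by blast
      then show ?thesis
        using w [OF a] by (intro binom_mean_expansion) auto
    qed
    then have "(\<lambda>n. \<Sum>a\<in>cells I J. case_prod m a * (binom_mean (w a) n (g a)
          - (\<alpha> a / w a / n + (\<alpha> a * (1 - w a) + \<beta> a) / (w a)\<^sup>2 / (real n)\<^sup>2))) \<in> o(\<lambda>n. 1 / (real n)\<^sup>2)"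
      by (intro big_sum_in_smallo) (auto simp del: split_paired_All)
    also have "(\<lambda>n. \<Sum>a\<in>cells I J. case_prod m a * (binom_mean (w a) n (g a)
          - (\<alpha> a / w a / n + (\<alpha> a * (1 - w a) + \<beta> a) / (w a)\<^sup>2 / (real n)\<^sup>2)))
        = (\<lambda>n. measure_pmf.expectation (?M n) D - ((\<Sum>a\<in>cells I J. (1 - q a) / 2) / n
            + (\<Sum>a\<in>cells I J. (1 - q a) * (1 - w a) / (2 * w a) + (1 / q a - q a) / (12 * w a)) / (real n)\<^sup>2))"
      unfolding E sum_divide_distrib sum.distrib [symmetric] sum_subtractf [symmetric]
    proof (intro ext sum.cong refl)
      fix n a assume a: "a \<in> cells I J"
      have 1: "w a * q a * (\<alpha> a / w a) = (1 - q a) / 2"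
        using w [OF a] q [OF a] by (simp add: \<alpha>_def)
      have 2: "w a * q a * ((\<alpha> a * (1 - w a) + \<beta> a) / (w a)\<^sup>2)
          = (1 - q a) * (1 - w a) / (2 * w a) + (1 / q a - q a) / (12 * w a)"
        using w [OF a] q [OF a] by (simp add: \<alpha>_def \<beta>_def field_simps power2_eq_square)
      show "case_prod m a * (binom_mean (w a) n (g a)
          - (\<alpha> a / w a / n + (\<alpha> a * (1 - w a) + \<beta> a) / (w a)\<^sup>2 / (real n)\<^sup>2))
         = case_prod m a * binom_mean (w a) n (g a) - ((1 - q a) / 2 / n
           + ((1 - q a) * (1 - w a) / (2 * w a) + (1 / q a - q a) / (12 * w a)) / (real n)\<^sup>2)"
        unfolding 1 [symmetric] 2 [symmetric] mq [OF a]
        by (simp only: right_diff_distrib distrib_left times_divide_eq_right)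
    qed
    finally show ?thesis .
  qed

  define B where "B = (\<Sum>a\<in>cells I J. w a * (1 + \<bar>ln (q a)\<bar>))"
  have D_bounded: "\<bar>D x\<bar> \<le> B" for x
    unfolding D_def B_def
  proof (intro order.trans [OF sum_abs] sum_mono)
    fix a assume a: "a \<in> cells I J"
    have "X x {a} \<le> X x (G a)"
      unfolding X_def using G [OF a] finG [OF a] by (intro sum_mono2) auto
    then have "real (X x {a}) / real (X x (G a)) \<le> 1"
      by (cases "X x (G a) = 0") auto
    then have "\<bar>real (X x {a}) / real (X x (G a)) * ln (real (X x {a}) / real (X x (G a)) / q a)\<bar> \<le> 1 + \<bar>ln (q a)\<bar>"
      by (intro abs_x_ln_x_div_le q a) auto
    then have "\<bar>w a\<bar> * \<bar>real (X x {a}) / real (X x (G a)) * ln (real (X x {a}) / real (X x (G a)) / q a)\<bar>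
        \<le> w a * (1 + \<bar>ln (q a)\<bar>)"
      using w [OF a] by (simp only: abs_of_pos mult_le_cancel_left_pos)
    then show "\<bar>\<phi> a (X x {a}) (X x (G a))\<bar> \<le> w a * (1 + \<bar>ln (q a)\<bar>)"
      unfolding abs_mult [symmetric] \<phi>_def mq [OF a] using q [OF a] by simp
  qed
  have KL: "KL_div I J (est n x) m = D x"
    if "n > 0" "x \<in> set_pmf (?M n)" "x \<in> ?A" for n x
    unfolding KL_div_def D_def
  proof (intro sum.cong refl, clarify)
    fix i j assume a: "(i, j) \<in> cells I J"
    have "est n x i j = w (i, j) * real (X x {(i, j)}) / real (X x (G (i, j)))"
      using est [OF that a] by (simp add: X_def)
    moreover have "m i j = w (i, j) * q (i, j)"
      using mq [OF a] by simp
    ultimately show "est n x i j * ln (est n x i j / m i j) = \<phi> (i, j) (X x {(i, j)}) (X x (G (i, j)))"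
      using w [OF a] q [OF a] by (simp add: \<phi>_def)
  qed

  let ?c = "\<lambda>i. \<Sum>j = 1..J i. m i j"
  have exp_small: "(\<lambda>n. \<Sum>i = 1..I. (1 - ?c i) ^ n) \<in> o(\<lambda>n. 1 / (real n)\<^sup>2)"
  proof (intro big_sum_in_smallo)
    fix i assume "i \<in> {1..I}"
    then obtain r where r: "1 - ?c i = r" "0 < r" "r < 1"
      using c by fastforce
    show "(\<lambda>n. (1 - ?c i) ^ n) \<in> o(\<lambda>n. 1 / (real n)\<^sup>2)"
      unfolding r(1) using r(2,3) by real_asymp
  qed
  have "norm (1 - ?c i) < 1" if "i \<in> {1..I}" for i
    using c [OF that] by (simp add: abs_if)
  then have "(\<lambda>n. \<Sum>i = 1..I. (1 - ?c i) ^ n) \<longlonglongrightarrow> 0"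
    by (intro tendsto_null_sum LIMSEQ_power_zero)
  then have "eventually (\<lambda>n. (\<Sum>i = 1..I. (1 - ?c i) ^ n) < 1) sequentially"
    by (rule order_tendstoD) simp
  then have "eventually (\<lambda>n. norm (risk I J m n (est n) - measure_pmf.expectation (?M n) D)
      \<le> 2 * B * norm (\<Sum>i = 1..I. (1 - ?c i) ^ n)) sequentially"
    using eventually_gt_at_top [of 0]
  proof eventually_elim
    case (elim n)
    have P: "measure_pmf.prob (?M n) (- ?A) \<le> (\<Sum>i = 1..I. (1 - ?c i) ^ n)"
      using c by (intro prob_empty_group_le m) auto
    \<comment> \<open>For small \<open>n\<close> the conditioning event can be impossible; here the
      discarded probability is already below 1.\<close>
    have ne: "set_pmf (?M n) \<inter> ?A \<noteq> {}"
    proof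
      assume "set_pmf (?M n) \<inter> ?A = {}"
      then have "measure_pmf.prob (?M n) (- ?A) = 1"
        by (subst measure_pmf.prob_eq_1) (auto simp: AE_measure_pmf_iff)
      then show False using P elim by simp
    qed
    have "risk I J m n (est n) = measure_pmf.expectation (cond_pmf (?M n) ?A) D"
      unfolding risk_def using KL elim ne
      by (intro integral_cong_AE) (auto simp: AE_measure_pmf_iff)
    then have "\<bar>risk I J m n (est n) - measure_pmf.expectation (?M n) D\<bar> \<le> 2 * B * measure_pmf.prob (?M n) (- ?A)"
      using expectation_cond_pmf_diff_le [OF finite_set_multinomial_pmf [OF m] ne D_bounded] by simp
    also have "\<dots> \<le> 2 * B * (\<Sum>i = 1..I. (1 - ?c i) ^ n)"
      using P order.trans [OF abs_ge_zero D_bounded] by (intro mult_left_mono) auto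
    finally show ?case
      using order.trans [OF abs_ge_zero D_bounded] c
      by (auto intro!: order.trans [OF _ mult_left_mono [OF abs_ge_self]])
  qed
  then have "(\<lambda>n. risk I J m n (est n) - measure_pmf.expectation (?M n) D) \<in> O(\<lambda>n. \<Sum>i = 1..I. (1 - ?c i) ^ n)"
    by (rule bigoI)
  then have "(\<lambda>n. risk I J m n (est n) - measure_pmf.expectation (?M n) D) \<in> o(\<lambda>n. 1 / (real n)\<^sup>2)"
    using exp_small by (rule landau_o.big_small_trans)
  from sum_in_smallo(1) [OF this D_expansion] show ?thesis
    by (simp only: add_diff_eq diff_add_cancel)
qed

text \<open>Here every weight is 1, so only (1/m - m)/12 survives at second order, and the
  probabilities sum to 1.\<close>

lemma ED_full_expansion:
  assumes m: "m \<in> full_model I J" and mpos: "\<And>i j. (i, j) \<in> cells I J \<Longrightarrow> 0 < m i j"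
    and c: "\<And>i. i \<in> {1..I} \<Longrightarrow> 0 < (\<Sum>j = 1..J i. m i j) \<and> (\<Sum>j = 1..J i. m i j) < 1"
  shows "\<exists>a. (\<lambda>n. ED_full I J m n - (a / n + ((\<Sum>(i, j)\<in>cells I J. 1 / (12 * m i j)) - 1 / 12) / (real n)\<^sup>2))
     \<in> o(\<lambda>n. 1 / (real n)\<^sup>2)"
proof -
  have w: "(\<Sum>b\<in>cells I J. case_prod m b) = 1"
    using m by (simp add: full_model_def)
  have "(\<lambda>n. risk I J m n (mle I J n (full_model I J)) - ((\<Sum>a\<in>cells I J. (1 - case_prod m a / 1) / 2) / n
     + (\<Sum>a\<in>cells I J. (1 - case_prod m a / 1) * (1 - 1) / (2 * 1) + (1 / (case_prod m a / 1) - case_prod m a / 1) / (12 * 1)) / (real n)\<^sup>2))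
     \<in> o(\<lambda>n. 1 / (real n)\<^sup>2)"
  proof (rule risk_expansion [where G = "\<lambda>_. cells I J" and m = m, unfolded w])
    fix n x i j
    assume n: "n > 0" and x: "x \<in> set_pmf (multinomial_pmf I J m n)" and ij: "(i, j) \<in> cells I J"
    show "mle I J n (full_model I J) x i j = 1 * real (x i j) / real (\<Sum>b\<in>cells I J. case_prod x b)"
      unfolding mle_full_model [OF m x n ij] sum_counts [OF m x] by simp
  qed (use assms in auto)
  moreover have "(\<Sum>a\<in>cells I J. (1 - case_prod m a / 1) * (1 - 1) / (2 * 1) + (1 / (case_prod m a / 1) - case_prod m a / 1) / (12 * 1))
      = (\<Sum>a\<in>cells I J. (1 / (12 * case_prod m a)) - 1 / 12 * case_prod m a)"
    by (intro sum.cong) (auto simp: field_simps)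
  moreover have "\<dots> = (\<Sum>(i, j)\<in>cells I J. 1 / (12 * m i j)) - 1 / 12"
    unfolding sum_subtractf sum_distrib_left [symmetric] w by (simp add: case_prod_unfold)
  ultimately show ?thesis
    unfolding ED_full_def by auto
qed

text \<open>Within a group the conditional probabilities \<open>q\<close> sum to 1, so the sum of
  \<open>1 - q\<close> is \<open>J i - 1\<close>. Since \<open>q * w = m\<close>, the sum of 1/(12
  m) is the same as for the full model and cancels in the comparison.\<close>

lemma ED_sub_expansion:
  assumes m: "m \<in> full_model I J" and mpos: "\<And>i j. (i, j) \<in> cells I J \<Longrightarrow> 0 < m i j"
    and c: "\<And>i. i \<in> {1..I} \<Longrightarrow> 0 < c i \<and> c i < 1" "\<And>i. i \<in> {1..I} \<Longrightarrow> (\<Sum>j = 1..J i. m i j) = c i"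
  shows "\<exists>b. (\<lambda>n. ED_sub I J c m n - (b / n + ((\<Sum>(i, j)\<in>cells I J. 1 / (12 * m i j))
       + (\<Sum>i = 1..I. (real (J i) - 1) * (1 - c i) / (2 * c i) - 1 / (12 * c i))) / (real n)\<^sup>2))
     \<in> o(\<lambda>n. 1 / (real n)\<^sup>2)"
proof -
  define G where "G = (\<lambda>a :: nat \<times> nat. group I J (fst a))"
  define w where "w = (\<lambda>a. \<Sum>b\<in>G a. case_prod m b)"
  define q where "q = (\<lambda>a. case_prod m a / w a)"
  have w: "w (i, j) = c i" if "i \<in> {1..I}" for i j
    using c(2) [OF that] by (simp add: w_def G_def sum_group)
  have c1: "(\<Sum>i = 1..I. c i) = 1"
    using m c(2) by (simp add: full_model_def sum_cells)
  have "(\<lambda>n. risk I J m n (mle I J n (submodel I J c)) - ((\<Sum>a\<in>cells I J. (1 - q a) / 2) / n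
     + (\<Sum>a\<in>cells I J. (1 - q a) * (1 - w a) / (2 * w a) + (1 / q a - q a) / (12 * w a)) / (real n)\<^sup>2))
     \<in> o(\<lambda>n. 1 / (real n)\<^sup>2)"
    unfolding q_def w_def
  proof (rule risk_expansion [OF m])
    fix n x i j
    assume n: "n > 0" and x: "x \<in> set_pmf (multinomial_pmf I J m n)" "x \<in> no_empty_group I J"
      and ij: "(i, j) \<in> cells I J"
    then show "mle I J n (submodel I J c) x i j = (\<Sum>b\<in>G (i, j). case_prod m b) * real (x i j) / real (\<Sum>b\<in>G (i, j). case_prod x b)"
      using mle_submodel [OF m x _ c1 ij] c w [of i j]
      by (simp add: G_def sum_group w_def cells_def)
  next
    show "a \<in> G a \<and> G a \<subseteq> cells I J" if "a \<in> cells I J" for a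
      using that by (auto simp: G_def group_def cells_def)
  qed (use assms in auto)
  moreover have "(\<Sum>a\<in>cells I J. (1 - q a) * (1 - w a) / (2 * w a) + (1 / q a - q a) / (12 * w a))
      = (\<Sum>(i, j)\<in>cells I J. 1 / (12 * m i j)) + (\<Sum>i = 1..I. (real (J i) - 1) * (1 - c i) / (2 * c i) - 1 / (12 * c i))"
  proof -
    have "(\<Sum>a\<in>cells I J. (1 - q a) * (1 - w a) / (2 * w a) + (1 / q a - q a) / (12 * w a))
        = (\<Sum>(i, j)\<in>cells I J. (1 - m i j / c i) * ((1 - c i) / (2 * c i)) + (1 / (12 * m i j) - m i j / c i * (1 / (12 * c i))))"
    proof (intro sum.cong refl, clarify)
      fix i j assume ij: "(i, j) \<in> cells I J"
      then have "c i > 0" "m i j > 0" "w (i, j) = c i"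
        using c(1) [of i] mpos w [of i j] by (auto simp: cells_def)
      then show "(1 - q (i, j)) * (1 - w (i, j)) / (2 * w (i, j)) + (1 / q (i, j) - q (i, j)) / (12 * w (i, j))
          = (1 - m i j / c i) * ((1 - c i) / (2 * c i)) + (1 / (12 * m i j) - m i j / c i * (1 / (12 * c i)))"
        by (simp add: q_def field_simps)
    qed
    also have "\<dots> = (\<Sum>i = 1..I. (\<Sum>j = 1..J i. 1 / (12 * m i j)) + ((real (J i) - 1) * (1 - c i) / (2 * c i) - 1 / (12 * c i)))"
      unfolding sum_cells
    proof (intro sum.cong refl)
      fix i assume i: "i \<in> {1..I}"
      have "(\<Sum>j = 1..J i. m i j / c i) = 1"
        using c(1) [OF i] c(2) [OF i] by (simp add: sum_divide_distrib [symmetric])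
      then show "(\<Sum>j = 1..J i. (1 - m i j / c i) * ((1 - c i) / (2 * c i)) + (1 / (12 * m i j) - m i j / c i * (1 / (12 * c i))))
          = (\<Sum>j = 1..J i. 1 / (12 * m i j)) + ((real (J i) - 1) * (1 - c i) / (2 * c i) - 1 / (12 * c i))"
        unfolding sum.distrib sum_subtractf sum_distrib_right [symmetric] by simp
    qed
    finally show ?thesis
      by (simp add: sum_cells sum.distrib)
  qed
  ultimately show ?thesis
    unfolding ED_sub_def by metis
qed

section \<open>Comparison of the second-order coefficients\<close>

theorem corollary1:
  fixes I :: nat and J :: "nat \<Rightarrow> nat" and m :: "nat \<Rightarrow> nat \<Rightarrow> real" and c :: "nat \<Rightarrow> real"
    and a\<^sub>1 a\<^sub>2 b\<^sub>1 b\<^sub>2 :: real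
  assumes "I \<ge> 2"
    and "\<And>i j. i \<in> {1..I} \<Longrightarrow> j \<in> {1..J i} \<Longrightarrow> m i j > 0"
    and "(\<Sum>i = 1..I. \<Sum>j = 1..J i. m i j) = 1"
    and "\<And>i. i \<in> {1..I} \<Longrightarrow> (\<Sum>j = 1..J i. m i j) = c i"
    and "\<And>i. i \<in> {1..I} \<Longrightarrow> J i \<ge> 2"
    and "(\<lambda>n. ED_full I J m n - (a\<^sub>1 / real n + a\<^sub>2 / (real n)\<^sup>2)) \<in> o(\<lambda>n. 1 / (real n)\<^sup>2)"
    and "(\<lambda>n. ED_sub I J c m n - (b\<^sub>1 / real n + b\<^sub>2 / (real n)\<^sup>2)) \<in> o(\<lambda>n. 1 / (real n)\<^sup>2)"
  shows "b\<^sub>2 > a\<^sub>2"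
proof -
  have m: "m \<in> full_model I J" and mpos: "\<And>i j. (i, j) \<in> cells I J \<Longrightarrow> 0 < m i j"
    using assms(2,3) by (auto simp: full_model_def sum_cells) (auto simp: cells_def intro: less_imp_le)
  have c1: "(\<Sum>i = 1..I. c i) = 1"
    using assms(3,4) by simp
  have c0: "c i > 0" if i: "i \<in> {1..I}" for i
    unfolding assms(4) [OF i, symmetric] using assms(2) [OF i] assms(5) [OF i] by (intro sum_pos) auto
  have c: "0 < c i \<and> c i < 1" if i: "i \<in> {1..I}" for i
  proof -
    \<comment> \<open>A second group exists because \<open>I \<ge> 2\<close>; its positive mass
      keeps \<open>c i\<close> below 1.\<close>
    obtain k where k: "k \<in> {1..I}" "k \<noteq> i"
      using assms(1) by (cases "i = 1") (auto intro: that [of 1] that [of 2])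
    have "c i < c i + c k"
      using c0 [OF k(1)] by simp
    also have "\<dots> = (\<Sum>l\<in>{i, k}. c l)"
      using k by simp
    also have "\<dots> \<le> (\<Sum>l = 1..I. c l)"
      using i k c0 by (intro sum_mono2) (auto intro: less_imp_le)
    finally show ?thesis
      using c0 [OF i] c1 by simp
  qed
  define s where "s = (\<Sum>(i, j)\<in>cells I J. 1 / (12 * m i j))"
  obtain a where "(\<lambda>n. ED_full I J m n - (a / n + (s - 1 / 12) / (real n)\<^sup>2)) \<in> o(\<lambda>n. 1 / (real n)\<^sup>2)"
    using ED_full_expansion [OF m mpos] c assms(4) unfolding s_def by auto
  then have a2: "a\<^sub>2 = s - 1 / 12"
    by (rule expansion_coefficients_unique(2) [OF assms(6)])
  define t where "t = (\<lambda>i. (real (J i) - 1) * (1 - c i) / (2 * c i) - 1 / (12 * c i))"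
  obtain b where "(\<lambda>n. ED_sub I J c m n - (b / n + (s + (\<Sum>i = 1..I. t i)) / (real n)\<^sup>2)) \<in> o(\<lambda>n. 1 / (real n)\<^sup>2)"
    using ED_sub_expansion [OF m mpos c assms(4)] unfolding s_def t_def by blast
  then have b2: "b\<^sub>2 = s + (\<Sum>i = 1..I. t i)"
    by (rule expansion_coefficients_unique(2) [OF assms(7)])
  \<comment> \<open>A single \<open>t i\<close> can be negative when \<open>c i\<close> is close to
    1, so a bound that can be summed is needed: the tangent at \<open>c i = 1/2\<close> to the
    convex function 5/(12 c) - 1/2, the value of \<open>t i\<close> for
    \<open>J i = 2\<close>.\<close>
  have t: "7 / 6 - 5 / 3 * c i \<le> t i" if i: "i \<in> {1..I}" for i
  proof -
    have "1 * (1 - c i) / (2 * c i) - 1 / (12 * c i) - (7 / 6 - 5 / 3 * c i) = 5 * (2 * c i - 1)\<^sup>2 / (12 * c i)"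
      using c [OF i] by (simp add: field_simps power2_eq_square)
    also have "\<dots> \<ge> 0"
      using c [OF i] by simp
    finally have "7 / 6 - 5 / 3 * c i \<le> 1 * (1 - c i) / (2 * c i) - 1 / (12 * c i)"
      by simp
    also have "\<dots> \<le> t i"
      unfolding t_def using c [OF i] assms(5) [OF i]
      by (intro diff_right_mono divide_right_mono mult_right_mono) auto
    finally show ?thesis .
  qed
  \<comment> \<open>For \<open>I \<ge> 2\<close> this is at least 2/3, whereas the claim needs only
    a sum above -1/12.\<close>
  have "7 / 6 * real I - 5 / 3 = (\<Sum>i = 1..I. 7 / 6 - 5 / 3 * c i)"
    unfolding sum_subtractf sum_distrib_left [symmetric] c1 by simp
  also have "\<dots> \<le> (\<Sum>i = 1..I. t i)"
    by (intro sum_mono t)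
  finally show ?thesis
    using assms(1) by (simp add: a2 b2)
qed

end
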